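(* Let $1\le r\le m$ be integers and let $H$ be the $(m,r)$-downset graph. Let $\alpha=(\alpha_k)_{k=1}^r$ be a vector of non-negative integers such that $\binom{m-k}{r-k}$ divides $\alpha_k$ for each $1\leq k\leq r$ and $\alpha_r>0$. Then, for every graphon $W$, \[t_{H}^{\alpha}(W)\geq t_{K_2}(W)^{e_\alpha(H)},\] where $e_\alpha(H):=\sum_{k=1}^r k\binom{m}{k}\alpha_k$.
   Context: A graphon is a symmetric measurable function $W:[0,1]^2\to[0,1]$, and $t_{K_2}(W)=\int_{[0,1]^2}W(x,y)\,dx\,dy$. The $(m,r)$-downset graph is the bipartite graph with parts $A=[m]$ and $B$ = the set of subsets of $[m]$ of size between $1$ and $r$, where $a\in A$ is adjacent to $F\in B$ iff $a\in F$. For $F\subseteq[m]$ and $x=(x_1,\dots,x_m)\in[0,1]^m$ let $\rho(x_F)=\int_0^1\prod_{i\in F}W(x_i,y)\,dy$. For the symmetric weight vector $\alpha$ (weight $\alpha_k$ on every $F\in B$ with $|F|=k$), the weighted homomorphism density is $t_H^{\alpha}(W)=\mathbb{E}_{x}\left[\prod_{F\in B}\rho(x_F)^{\alpha_{|F|}}\right]$, where $x_1,\dots,x_m$ are independent uniform on $[0,1]$. *)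

theory Defs
  imports "HOL-Analysis.Analysis"
begin

(* Only the values of W on the unit square matter; measurability is Lebesgue measurability. *)
definition graphon :: "(real \<Rightarrow> real \<Rightarrow> real) \<Rightarrow> bool" where
  "graphon W \<longleftrightarrow>
     (\<lambda>(x, y). W x y) \<in> borel_measurable (lebesgue_on ({0..1} \<times> {0..1})) \<and>
     (\<forall>x\<in>{0..1}. \<forall>y\<in>{0..1}. W x y = W y x) \<and>
     (\<forall>x\<in>{0..1}. \<forall>y\<in>{0..1}. 0 \<le> W x y \<and> W x y \<le> 1)"

definition edge_density :: "(real \<Rightarrow> real \<Rightarrow> real) \<Rightarrow> real" where
  "edge_density W = (\<integral>(x, y). W x y \<partial>lebesgue_on ({0..1} \<times> {0..1}))"

(* Lebesgue measure on the cube of points x = (x_i) with i in A and x_i in [0,1], that is, the law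
   of independent uniform x_i. It is completed because W is only Lebesgue measurable: the
   functions of x integrated against it need not be measurable for the plain product. *)
definition unit_cube :: "'a set \<Rightarrow> ('a \<Rightarrow> real) measure" where
  "unit_cube A = completion (\<Pi>\<^sub>M i\<in>A. restrict_space lborel {0..1})"

(* For Lebesgue measurable W the integrand in y is measurable for almost every x. *)
definition rho :: "(real \<Rightarrow> real \<Rightarrow> real) \<Rightarrow> 'a set \<Rightarrow> ('a \<Rightarrow> real) \<Rightarrow> real" where
  "rho W F x = (\<integral>y. (\<Prod>i\<in>F. W (x i) y) \<partial>lebesgue_on {0..1})"

record ('a, 'b) bigraph =
  left_part :: "'a set"
  right_part :: "'b set"
  adjacent :: "'a \<Rightarrow> 'b \<Rightarrow> bool"

definition downset_graph :: "nat \<Rightarrow> nat \<Rightarrow> (nat, nat set) bigraph" where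
  "downset_graph m r =
     \<lparr>left_part = {1..m},
      right_part = {F. F \<subseteq> {1..m} \<and> 1 \<le> card F \<and> card F \<le> r},
      adjacent = (\<lambda>a F. a \<in> F)\<rparr>"

definition weighted_hom_density ::
    "('a, 'b) bigraph \<Rightarrow> ('b \<Rightarrow> nat) \<Rightarrow> (real \<Rightarrow> real \<Rightarrow> real) \<Rightarrow> real" where
  "weighted_hom_density H w W =
     (\<integral>x. (\<Prod>b\<in>right_part H. rho W {a \<in> left_part H. adjacent H a b} x ^ w b)
        \<partial>unit_cube (left_part H))"

(* In the downset graph the neighbourhood of F is F itself. *)
lemma weighted_hom_density_downset_graph:
  "weighted_hom_density (downset_graph m r) (\<lambda>F. \<alpha> (card F)) W =
     (\<integral>x. (\<Prod>F\<in>{F. F \<subseteq> {1..m} \<and> 1 \<le> card F \<and> card F \<le> r}. rho W F x ^ \<alpha> (card F))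
        \<partial>unit_cube {1..m})"
proof -
  have "{a \<in> {1..m}. a \<in> F} = F" if "F \<subseteq> {1..m}" for F
    using that by auto
  then show ?thesis
    unfolding weighted_hom_density_def downset_graph_def
    by (auto intro!: Bochner_Integration.integral_cong prod.cong)
qed

end

theory Submission
  imports Defs "HOL-Probability.Infinite_Product_Measure"
begin

text \<open>
Put \<open>\<beta>_k = \<alpha>_k / binom(m-k, r-k)\<close> and \<open>\<Psi>(x_G) = \<Prod>\<rho>(x_F)^\<beta>_|F|\<close>, the product over the nonempty
\<open>F \<subseteq> G\<close>. Every \<open>k\<close>-set lies in \<open>binom(m-k, r-k)\<close> sets of size \<open>r\<close>, so the integrand of \<open>t_H^\<alpha>(W)\<close> is the
product of \<open>\<Psi>(x_G)\<close> over all \<open>r\<close>-sets \<open>G \<subseteq> [m]\<close>. For a family \<open>\<G>\<close> of \<open>r\<close>-sets let \<open>t(\<G>)\<close> be the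
expectation of the product of \<open>\<Psi>(x_G)\<close> over \<open>G \<in> \<G>\<close>.

For \<open>i \<noteq> j\<close>, the dependence of \<open>\<Psi>(x_G)\<close> on \<open>(x_i, x_j)\<close> is a positive semidefinite kernel if \<open>G\<close> contains
both or neither of \<open>i, j\<close>. By the Cauchy-Schwarz inequality, \<open>t(\<G>)^2 \<le> t(\<G>') t(\<G>'')\<close>, where \<open>\<G>'\<close> and \<open>\<G>''\<close>
arise from \<open>\<G>\<close> by replacing the sets that contain only \<open>j\<close> by the mirror images of those that contain
only \<open>i\<close>, and vice versa. Hence the maximisers of \<open>t(\<G>)^(1/|\<G>|)\<close> are closed under these foldings; as foldings
lead from any nonempty family to the complete one, a single \<open>r\<close>-set \<open>G\<close> satisfies
\<open>t({G})^binom(m,r) \<le> t_H^\<alpha>(W)\<close>.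

It remains to bound \<open>t({G})\<close> from below by the corresponding power of the edge density, which follows from
the inequality of arithmetic and geometric means under the distribution of \<open>r\<close> independent neighbours of
a random vertex chosen proportionally to its degree.
\<close>

subsection \<open>Folding families of sets\<close>

abbreviation transposition :: "'a \<Rightarrow> 'a \<Rightarrow> 'a \<Rightarrow> 'a" where
  "transposition \<equiv> Transposition.transpose"

definition balanced_sets :: "'a \<Rightarrow> 'a \<Rightarrow> 'a set set \<Rightarrow> 'a set set" where
  "balanced_sets i j \<G> = {G \<in> \<G>. i \<in> G \<longleftrightarrow> j \<in> G}"

text \<open>Of the sets that the transposition of i and j moves, these form the half on the side of
  i.\<close>

definition moved_sets :: "'a \<Rightarrow> 'a \<Rightarrow> 'a set set \<Rightarrow> 'a set set" where
  "moved_sets i j \<G> = {G \<in> \<G>. i \<in> G \<and> j \<notin> G}"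

text \<open>For \<open>i j\<close> this is \<G>' of the overview, for \<open>j i\<close> it is
  \<G>''. Balanced sets are their own mirror images and stay in both.\<close>

definition fold_family :: "'a \<Rightarrow> 'a \<Rightarrow> 'a set set \<Rightarrow> 'a set set" where
  "fold_family i j \<G> = balanced_sets i j \<G> \<union>
     (moved_sets i j \<G> \<union> (`) (transposition i j) ` moved_sets i j \<G>)"

lemma mem_transpose_image: "a \<in> transposition i j ` G \<longleftrightarrow> transposition i j a \<in> G"
  by (metis image_iff transpose_involutory)

lemma transpose_image_image [simp]: "transposition i j ` transposition i j ` G = G"
  by (simp add: image_image)

lemma transpose_image_fixed: "(i \<in> G \<longleftrightarrow> j \<in> G) \<Longrightarrow> transposition i j ` G = G"
  by (auto simp: set_eq_iff mem_transpose_image Transposition.transpose_def)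

lemma card_transpose_image [simp]: "card (transposition i j ` G) = card G"
  by (simp add: card_image)

lemma transpose_image_subset: "G \<subseteq> I \<Longrightarrow> i \<in> I \<Longrightarrow> j \<in> I \<Longrightarrow> transposition i j ` G \<subseteq> I"
  by (auto simp: Transposition.transpose_def)

lemma inj_transpose_image: "inj_on ((`) (transposition i j)) A"
  by (rule inj_on_inverseI[where g = "(`) (transposition i j)"]) simp

lemma fold_family_subset:
  assumes "\<G> \<subseteq> {G. G \<subseteq> I \<and> card G = r}" "i \<in> I" "j \<in> I"
  shows "fold_family i j \<G> \<subseteq> {G. G \<subseteq> I \<and> card G = r}"
proof
  fix G assume "G \<in> fold_family i j \<G>"
  then consider "G \<in> \<G>" | G' where "G' \<in> \<G>" "G = transposition i j ` G'"
    by (auto simp: fold_family_def balanced_sets_def moved_sets_def)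
  then show "G \<in> {G. G \<subseteq> I \<and> card G = r}"
  proof cases
    case 2
    then have "G' \<subseteq> I" "card G' = r" using assms by auto
    then show ?thesis
      using 2 assms(2,3) transpose_image_subset[of G' I i j] by simp
  qed (use assms in auto)
qed

text \<open>The three parts are told apart by which of i and j they contain; products over a folded
  family therefore split into three factors.\<close>

lemma fold_family_disjoint:
  "balanced_sets i j \<G> \<inter> (moved_sets i j \<G> \<union> (`) (transposition i j) ` moved_sets i j \<G>) = {}"
  "moved_sets i j \<G> \<inter> (`) (transposition i j) ` moved_sets i j \<G> = {}"
proof -
  have "i \<notin> transposition i j ` G" "j \<in> transposition i j ` G" if "i \<in> G" "j \<notin> G" for G
    using that by (simp_all add: mem_transpose_image)
  then show
    "balanced_sets i j \<G> \<inter> (moved_sets i j \<G> \<union> (`) (transposition i j) ` moved_sets i j \<G>) = {}"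
    "moved_sets i j \<G> \<inter> (`) (transposition i j) ` moved_sets i j \<G> = {}"
    unfolding balanced_sets_def moved_sets_def by blast+
qed

lemma family_decomposition:
  "balanced_sets i j \<G> \<inter> (moved_sets i j \<G> \<union> moved_sets j i \<G>) = {}"
  "moved_sets i j \<G> \<inter> moved_sets j i \<G> = {}"
  "balanced_sets i j \<G> \<union> (moved_sets i j \<G> \<union> moved_sets j i \<G>) = \<G>"
  "balanced_sets j i \<G> = balanced_sets i j \<G>"
  unfolding balanced_sets_def moved_sets_def by blast+

lemma finite_family_parts [simp]:
  "finite \<G> \<Longrightarrow> finite (balanced_sets i j \<G>)" "finite \<G> \<Longrightarrow> finite (moved_sets i j \<G>)"
  by (simp_all add: balanced_sets_def moved_sets_def)

text \<open>A moved set counts twice in one folding and not at all in the other. This identity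
  balances the exponents in the extremal argument.\<close>

lemma card_fold_family:
  assumes "finite \<G>"
  shows "card (fold_family i j \<G>) + card (fold_family j i \<G>) = 2 * card \<G>"
proof -
  have cf: "card (fold_family i j \<G>) = card (balanced_sets i j \<G>) + 2 * card (moved_sets i j \<G>)"
    for i j
    using assms fold_family_disjoint[of i j \<G>]
    by (simp add: fold_family_def card_Un_disjoint card_image inj_transpose_image)
  have "card \<G> = card (balanced_sets i j \<G> \<union> (moved_sets i j \<G> \<union> moved_sets j i \<G>))"
    unfolding family_decomposition ..
  also have "\<dots> = card (balanced_sets i j \<G>) + (card (moved_sets i j \<G>) + card (moved_sets j i \<G>))"
    using assms by (simp add: card_Un_disjoint family_decomposition(1,2))
  finally show ?thesis
    using cf[of i j] cf[of j i] family_decomposition(4)[of j i \<G>] by simp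
qed

text \<open>Frees the element a of S, where E is any property that folding preserves. Folding along
  a and each j in J in turn adds the mirror images of sets with a but not j; the application takes J
  to be all of \<open>I - S\<close>.\<close>

lemma fold_family_percolation_step:
  assumes "finite I" "\<And>i j \<G>. E \<G> \<Longrightarrow> i \<in> I \<Longrightarrow> j \<in> I \<Longrightarrow> i \<noteq> j \<Longrightarrow> E (fold_family i j \<G>)"
    and "E \<G>" "{G. S \<subseteq> G \<and> G \<subseteq> I \<and> card G = r} \<subseteq> \<G>" "a \<in> S" "S \<subseteq> I"
    and "finite J" "J \<subseteq> I - S"
  shows "\<exists>\<G>'. E \<G>' \<and>
    {G. S - {a} \<subseteq> G \<and> G \<subseteq> I \<and> card G = r \<and> (a \<in> G \<or> G \<inter> J \<noteq> {})} \<subseteq> \<G>'"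
  using assms(7,8)
proof (induction J rule: finite_induct)
  case empty
  then show ?case using assms(3,4) by blast
next
  case (insert j J)
  then obtain \<G>' where \<G>': "E \<G>'"
    "{G. S - {a} \<subseteq> G \<and> G \<subseteq> I \<and> card G = r \<and> (a \<in> G \<or> G \<inter> J \<noteq> {})} \<subseteq> \<G>'"
    by auto
  have "a \<noteq> j" "j \<in> I" "a \<in> I" using insert assms(5,6) by auto
  have fold: "G \<in> fold_family a j \<G>'"
    if G: "S - {a} \<subseteq> G" "G \<subseteq> I" "card G = r" "a \<in> G \<or> G \<inter> insert j J \<noteq> {}" for G
  proof (cases "a \<in> G \<or> j \<notin> G")
    case True
    \<comment> \<open>A set that contains a or avoids j is either balanced or on the side of a, so
      folding keeps it.\<close>
    then have "G \<in> \<G>'" using G \<G>'(2) by auto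
    then show ?thesis using True by (auto simp: fold_family_def balanced_sets_def moved_sets_def)
  next
    case False
    let ?G = "transposition a j ` G"
    have "?G \<subseteq> I" "card ?G = r" "a \<in> ?G" "j \<notin> ?G"
      using G False transpose_image_subset[of G I a j] \<open>a \<in> I\<close> \<open>j \<in> I\<close>
      by (simp_all add: mem_transpose_image)
    \<comment> \<open>j lies outside S, so exchanging a and j does not disturb
      \<open>S - {a}\<close>.\<close>
    moreover have "S - {a} \<subseteq> ?G"
      using G(1) insert.prems by (auto simp: mem_transpose_image Transposition.transpose_def)
    ultimately have "?G \<in> moved_sets a j \<G>'" using \<G>'(2) by (auto simp: moved_sets_def)
    then have "transposition a j ` ?G \<in> fold_family a j \<G>'" unfolding fold_family_def by blast
    then show ?thesis by simp
  qed
  show ?case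
  proof (intro exI conjI)
    show "E (fold_family a j \<G>')"
      using assms(2) \<G>'(1) \<open>a \<in> I\<close> \<open>j \<in> I\<close> \<open>a \<noteq> j\<close> by simp
    show "{G. S - {a} \<subseteq> G \<and> G \<subseteq> I \<and> card G = r \<and> (a \<in> G \<or> G \<inter> insert j J \<noteq> {})}
        \<subseteq> fold_family a j \<G>'"
      by (intro subsetI, elim CollectE conjE, rule fold)
  qed
qed

text \<open>Start with S = G, whose only superset of size r is G itself, and free the elements of G
  one at a time until S is empty.\<close>

lemma fold_family_percolation:
  assumes "finite I" "\<And>i j \<G>. E \<G> \<Longrightarrow> i \<in> I \<Longrightarrow> j \<in> I \<Longrightarrow> i \<noteq> j \<Longrightarrow> E (fold_family i j \<G>)"
    and "E \<G>" "G \<in> \<G>" "G \<subseteq> I" "card G = r"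
  shows "\<exists>\<G>'. E \<G>' \<and> {G. G \<subseteq> I \<and> card G = r} \<subseteq> \<G>'"
proof -
  have "finite G" using assms(1,5) finite_subset by blast
  have "\<exists>\<G>'. E \<G>' \<and> {G'. G - T \<subseteq> G' \<and> G' \<subseteq> I \<and> card G' = r} \<subseteq> \<G>'"
    if "finite T" "T \<subseteq> G" for T
    using that
  proof (induction T rule: finite_induct)
    case empty
    have "G' = G" if "G \<subseteq> G'" "G' \<subseteq> I" "card G' = r" for G'
      using that assms(1,6) card_subset_eq[of G' G] finite_subset[of G' I] by simp
    then have "{G'. G - {} \<subseteq> G' \<and> G' \<subseteq> I \<and> card G' = r} \<subseteq> {G}"
      by auto
    then show ?case using assms(3,4) by blast
  next
    case (insert a T)
    then obtain \<G>' where \<G>': "E \<G>'" "{G'. G - T \<subseteq> G' \<and> G' \<subseteq> I \<and> card G' = r} \<subseteq> \<G>'"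
      by auto
    obtain \<H> where \<H>: "E \<H>" "{G'. G - T - {a} \<subseteq> G' \<and> G' \<subseteq> I \<and> card G' = r \<and>
        (a \<in> G' \<or> G' \<inter> (I - (G - T)) \<noteq> {})} \<subseteq> \<H>"
      using fold_family_percolation_step[where J = "I - (G - T)" and a = a and E = E,
          OF assms(1) assms(2) \<G>'] insert assms(1,5) by auto
    \<comment> \<open>An r-set that avoids both a and the complement of \<open>G - T\<close> would
      lie in \<open>G - {a}\<close>, which is too small; hence the side condition of the step always
      holds.\<close>
    have "a \<in> G' \<or> G' \<inter> (I - (G - T)) \<noteq> {}" if "G' \<subseteq> I" "card G' = r" for G'
    proof (rule ccontr)
      assume "\<not> ?thesis"
      then have "G' \<subseteq> G - {a}" using that by auto
      then have "card G' \<le> card (G - {a})" using \<open>finite G\<close> by (intro card_mono) auto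
      also have "\<dots> < card G" using \<open>finite G\<close> insert.prems by (intro card_Diff1_less) auto
      finally show False using that assms(6) by simp
    qed
    then have "{G'. G - insert a T \<subseteq> G' \<and> G' \<subseteq> I \<and> card G' = r} \<subseteq> \<H>"
      using \<H>(2) by (auto simp: Diff_insert[of G a T] Diff_insert2[of G a T])
    then show ?case using \<H>(1) by (intro exI conjI)
  qed
  from this[OF \<open>finite G\<close> subset_refl] show ?thesis by simp
qed

(* The families maximising t(\<G>)^(1/|\<G>|) are closed under folding, and folding leads from any
   nonempty family to the complete one. *)
lemma single_edge_le_complete:
  fixes t :: "'a set set \<Rightarrow> real"
  assumes "finite I" and \<K>: "\<K> = {G. G \<subseteq> I \<and> card G = r}"
    and nonneg: "\<And>\<G>. \<G> \<subseteq> \<K> \<Longrightarrow> 0 \<le> t \<G>" and empty: "t {} = 1"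
    and fold: "\<And>i j \<G>. \<G> \<subseteq> \<K> \<Longrightarrow> i \<in> I \<Longrightarrow> j \<in> I \<Longrightarrow> i \<noteq> j \<Longrightarrow>
      (t \<G>)\<^sup>2 \<le> t (fold_family i j \<G>) * t (fold_family j i \<G>)"
    and "G\<^sub>0 \<in> \<K>"
  shows "t {G\<^sub>0} ^ card \<K> \<le> t \<K>"
proof (cases "t {G\<^sub>0} = 0")
  case True
  have "finite \<K>" using assms(1) \<K> by simp
  then have "card \<K> > 0" using assms(6) by (auto simp: card_gt_0_iff)
  then show ?thesis using True nonneg[of \<K>] by (simp add: zero_power)
next
  case False
  \<comment> \<open>Positivity passes to M, whose powers are cancelled below.\<close>
  then have pos: "t {G\<^sub>0} > 0" using nonneg[of "{G\<^sub>0}"] assms(6) by simp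
  have fin: "finite \<K>" using assms(1) \<K> by simp
  define \<F> where "\<F> = Pow \<K> - {{}}"
  define M where "M = Max ((\<lambda>\<G>. t \<G> powr (1 / card \<G>)) ` \<F>)"
  have "finite \<F>" and G0: "{G\<^sub>0} \<in> \<F>" using fin assms(6) by (auto simp: \<F>_def)
  have M_ge: "t \<G> powr (1 / card \<G>) \<le> M" if "\<G> \<in> \<F>" for \<G>
    unfolding M_def using that \<open>finite \<F>\<close> by (intro Max_ge) auto
  have "M \<in> (\<lambda>\<G>. t \<G> powr (1 / card \<G>)) ` \<F>"
    unfolding M_def using G0 \<open>finite \<F>\<close> by (intro Max_in) auto
  then obtain \<G>\<^sub>0 where \<G>\<^sub>0: "\<G>\<^sub>0 \<in> \<F>" "t \<G>\<^sub>0 powr (1 / card \<G>\<^sub>0) = M" by auto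
  have single: "t {G\<^sub>0} \<le> M" using M_ge[OF G0] pos by simp
  then have "M > 0" using pos by linarith
  have card_pos: "card \<G> > 0" if "\<G> \<in> \<F>" for \<G>
    using that fin finite_subset by (auto simp: \<F>_def card_gt_0_iff)
  have root: "(t \<G> powr (1 / card \<G>)) ^ card \<G> = t \<G>" if "\<G> \<in> \<F>" for \<G>
    using card_pos[OF that] nonneg[of \<G>] that
    by (cases "t \<G> = 0") (auto simp: powr_realpow[symmetric] powr_powr \<F>_def)
  \<comment> \<open>The empty family is covered too, since a folding of a nonempty family can be
    empty.\<close>
  have le: "t \<G> \<le> M ^ card \<G>" if "\<G> \<subseteq> \<K>" for \<G>
  proof (cases "\<G> = {}")
    case True
    then show ?thesis using empty by simp
  next
    case False
    then have "\<G> \<in> \<F>" using that by (auto simp: \<F>_def)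
    then show ?thesis using power_mono[OF M_ge, of \<G> "card \<G>"] root by simp
  qed
  define E where "E = (\<lambda>\<G>. \<G> \<subseteq> \<K> \<and> t \<G> = M ^ card \<G>)"
  have E_fold: "E (fold_family i j \<G>)" if "E \<G>" "i \<in> I" "j \<in> I" "i \<noteq> j" for i j \<G>
  proof -
    have "\<G> \<subseteq> \<K>" using that by (simp add: E_def)
    have sub: "fold_family i j \<G> \<subseteq> \<K>" "fold_family j i \<G> \<subseteq> \<K>"
      using fold_family_subset[of \<G> I r] \<open>\<G> \<subseteq> \<K>\<close> that unfolding \<K> by auto
    have "finite \<G>" using fin \<open>\<G> \<subseteq> \<K>\<close> finite_subset by blast
    \<comment> \<open>Each factor of the folding inequality is at most its power of M, while the
      product reaches the product of these powers; so the first factor is extremal as well.\<close>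
    have "M ^ card (fold_family i j \<G>) * M ^ card (fold_family j i \<G>) = (M ^ card \<G>)\<^sup>2"
      using card_fold_family[OF \<open>finite \<G>\<close>, of i j]
      by (simp add: power_add[symmetric] power_mult[symmetric] mult.commute)
    also have "\<dots> = (t \<G>)\<^sup>2" using that by (simp add: E_def)
    also have "\<dots> \<le> t (fold_family i j \<G>) * t (fold_family j i \<G>)"
      using fold \<open>\<G> \<subseteq> \<K>\<close> that by blast
    also have "\<dots> \<le> t (fold_family i j \<G>) * M ^ card (fold_family j i \<G>)"
      using le[OF sub(2)] nonneg[OF sub(1)] by (intro mult_left_mono)
    finally have "M ^ card (fold_family i j \<G>) \<le> t (fold_family i j \<G>)"
      using \<open>M > 0\<close> by simp
    then show ?thesis using le[OF sub(1)] sub(1) by (simp add: E_def)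
  qed
  have "E \<G>\<^sub>0" using root[OF \<G>\<^sub>0(1)] \<G>\<^sub>0 by (simp add: E_def \<F>_def)
  obtain G where "G \<in> \<G>\<^sub>0" using \<G>\<^sub>0(1) by (auto simp: \<F>_def)
  have "G \<subseteq> I" "card G = r" using \<open>G \<in> \<G>\<^sub>0\<close> \<G>\<^sub>0(1) \<K> by (auto simp: \<F>_def)
  obtain \<G>' where "E \<G>'" "\<K> \<subseteq> \<G>'"
    using fold_family_percolation[where E = E, OF assms(1) E_fold \<open>E \<G>\<^sub>0\<close> \<open>G \<in> \<G>\<^sub>0\<close> \<open>G \<subseteq> I\<close>
      \<open>card G = r\<close>] unfolding \<K> by auto
  then have "t \<K> = M ^ card \<K>" by (auto simp: E_def)
  then show ?thesis using single pos by (simp add: power_mono)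
qed

subsection \<open>Resampling coordinates of the cube\<close>

abbreviation unit_lborel :: "real measure" where
  "unit_lborel \<equiv> restrict_space lborel {0..1}"

abbreviation cube :: "'i set \<Rightarrow> ('i \<Rightarrow> real) measure" where
  "cube I \<equiv> \<Pi>\<^sub>M i\<in>I. unit_lborel"

abbreviation unit_square :: "(real \<times> real) measure" where
  "unit_square \<equiv> unit_lborel \<Otimes>\<^sub>M unit_lborel"

lemma space_unit_lborel: "space unit_lborel = {0..1}"
  by (simp add: space_restrict_space)

lemma prob_space_unit_lborel: "prob_space unit_lborel"
  by (rule prob_spaceI) (simp add: space_unit_lborel emeasure_restrict_space)

interpretation unit: prob_space unit_lborel
  by (rule prob_space_unit_lborel)

interpretation unit_square: pair_prob_space unit_lborel unit_lborel ..

interpretation unit_square: sigma_finite_measure unit_square ..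

interpretation cube: product_sigma_finite "\<lambda>_::'i. unit_lborel"
  by unfold_locales

lemma prob_space_cube: "prob_space (cube I)"
  by (rule prob_space_PiM) (rule prob_space_unit_lborel)

lemma measurable_cube_upd:
  assumes "i \<in> I"
  shows "(\<lambda>(x, s). x(i := s)) \<in> cube I \<Otimes>\<^sub>M unit_lborel \<rightarrow>\<^sub>M cube I"
  using measurable_add_dim[of i I "\<lambda>_. unit_lborel"] insert_absorb[OF assms] by simp

lemma measurable_cube_updI [measurable (raw)]:
  assumes "i \<in> I" "f \<in> M \<rightarrow>\<^sub>M cube I" "g \<in> M \<rightarrow>\<^sub>M unit_lborel"
  shows "(\<lambda>z. (f z)(i := g z)) \<in> M \<rightarrow>\<^sub>M cube I"
  using measurable_compose[OF measurable_Pair[OF assms(2,3)] measurable_cube_upd[OF assms(1)]]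
  by simp

text \<open>Replacing the coordinate i by a fresh uniform point does not change the law of x. Both
  sides reduce to integrals over the cube without i; the old value of the coordinate is integrated
  over mass 1.\<close>

lemma nn_integral_resample:
  assumes "finite I" "i \<in> I" and f: "f \<in> borel_measurable (cube I)"
  shows "(\<integral>\<^sup>+x. f x \<partial>cube I) = (\<integral>\<^sup>+x. \<integral>\<^sup>+s. f (x(i := s)) \<partial>unit_lborel \<partial>cube I)"
proof -
  have I: "insert i (I - {i}) = I" using assms(2) by auto
  have rem: "(\<integral>\<^sup>+x. g x \<partial>cube I) = (\<integral>\<^sup>+x. \<integral>\<^sup>+s. g (x(i := s)) \<partial>unit_lborel \<partial>cube (I - {i}))"
    if "g \<in> borel_measurable (cube I)" for g
    using cube.product_nn_integral_insert[of "I - {i}" i g] that assms(1) unfolding I by simp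
  have [measurable]: "(\<lambda>x. \<integral>\<^sup>+s. f (x(i := s)) \<partial>unit_lborel) \<in> borel_measurable (cube I)"
    using assms(2) f by measurable
  show ?thesis
    by (subst (1 2) rem) (simp_all add: f unit.emeasure_space_1[unfolded space_unit_lborel])
qed

lemma nn_integral_resample2:
  assumes "finite I" "i \<in> I" "j \<in> I" and f [measurable]: "f \<in> borel_measurable (cube I)"
  shows "(\<integral>\<^sup>+x. f x \<partial>cube I) =
    (\<integral>\<^sup>+x. \<integral>\<^sup>+s. \<integral>\<^sup>+t. f (x(i := s, j := t)) \<partial>unit_lborel \<partial>unit_lborel \<partial>cube I)"
proof -
  have [measurable]: "(\<lambda>x. \<integral>\<^sup>+t. f (x(j := t)) \<partial>unit_lborel) \<in> borel_measurable (cube I)"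
    using assms(3) by measurable
  show ?thesis
    using assms by (subst nn_integral_resample[of I j], simp_all, subst nn_integral_resample[of I i]) simp_all
qed

text \<open>The map \<open>?T\<close> carries the product law to the law of the cube. This is
  checked on indicators with nonnegative integrals and transferred to real functions, where B
  supplies integrability for Fubini.\<close>

lemma integral_resample2:
  fixes f :: "('i \<Rightarrow> real) \<Rightarrow> real"
  assumes "finite I" "i \<in> I" "j \<in> I" and f [measurable]: "f \<in> borel_measurable (cube I)"
    and bound: "\<And>x. x \<in> space (cube I) \<Longrightarrow> \<bar>f x\<bar> \<le> B"
  shows "(\<integral>x. f x \<partial>cube I) =
    (\<integral>x. \<integral>z. f (x(i := fst z, j := snd z)) \<partial>unit_square \<partial>cube I)"
proof -
  let ?Q = "cube I \<Otimes>\<^sub>M unit_square"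
  let ?T = "\<lambda>(x, z). x(i := fst z, j := snd z)"
  interpret cube: prob_space "cube I" by (rule prob_space_cube)
  interpret Q: pair_prob_space "cube I" unit_square ..
  note [simp] = assms(2,3)
  have T [measurable]: "?T \<in> ?Q \<rightarrow>\<^sub>M cube I" by measurable
  have "distr ?Q (cube I) ?T = cube I"
  proof (rule measure_eqI)
    fix A assume "A \<in> sets (distr ?Q (cube I) ?T)"
    then have A [measurable]: "A \<in> sets (cube I)" by simp
    have "emeasure (distr ?Q (cube I) ?T) A = (\<integral>\<^sup>+x. indicator A x \<partial>distr ?Q (cube I) ?T)"
      by (simp add: A)
    also have "\<dots> = (\<integral>\<^sup>+p. indicator A (?T p) \<partial>?Q)"
      by (rule nn_integral_distr) measurable
    also have "\<dots> = (\<integral>\<^sup>+x. \<integral>\<^sup>+z. indicator A (x(i := fst z, j := snd z))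
        \<partial>unit_square \<partial>cube I)"
      by (subst unit_square.nn_integral_fst[symmetric]) simp_all
    also have "\<dots> = (\<integral>\<^sup>+x. \<integral>\<^sup>+s. \<integral>\<^sup>+t. indicator A (x(i := s, j := t))
        \<partial>unit_lborel \<partial>unit_lborel \<partial>cube I)"
      by (intro nn_integral_cong, subst unit.nn_integral_fst[symmetric]) simp_all
    also have "\<dots> = (\<integral>\<^sup>+x. indicator A x \<partial>cube I)"
      by (rule nn_integral_resample2[symmetric]) (use assms in simp_all)
    finally show "emeasure (distr ?Q (cube I) ?T) A = emeasure (cube I) A"
      by (simp add: A)
  qed simp
  then have "(\<integral>x. f x \<partial>cube I) = (\<integral>x. f x \<partial>distr ?Q (cube I) ?T)"
    by simp
  also have "\<dots> = (\<integral>p. f (?T p) \<partial>?Q)"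
    by (rule integral_distr) measurable
  also have "\<dots> = (\<integral>x. \<integral>z. f (x(i := fst z, j := snd z)) \<partial>unit_square \<partial>cube I)"
  proof -
    have "integrable ?Q (\<lambda>p. f (?T p))"
      using measurable_space[OF T]
      by (intro Q.integrable_const_bound[where B = B] AE_I2) (auto intro!: bound)
    then show ?thesis
      by (subst Q.integral_fst'[symmetric]) simp_all
  qed
  finally show ?thesis .
qed

subsection \<open>Positive semidefinite kernels\<close>

text \<open>Test functions and kernels are taken bounded so that all their products are integrable
  on a probability space.\<close>

definition bounded_borel :: "'a measure \<Rightarrow> ('a \<Rightarrow> real) set" where
  "bounded_borel M = {f \<in> borel_measurable M. \<exists>B. \<forall>x\<in>space M. \<bar>f x\<bar> \<le> B}"

lemma bounded_borelI:
  assumes "f \<in> borel_measurable M" "\<And>x. x \<in> space M \<Longrightarrow> \<bar>f x\<bar> \<le> B"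
  shows "f \<in> bounded_borel M"
  using assms by (auto simp: bounded_borel_def)

lemma bounded_borel_unit_range:
  assumes "f \<in> borel_measurable M" "\<And>x. 0 \<le> f x" "\<And>x. f x \<le> 1"
  shows "f \<in> bounded_borel M"
  using assms by (intro bounded_borelI[where B = 1]) (simp_all add: abs_of_nonneg)

lemma bounded_borel_measurable: "f \<in> bounded_borel M \<Longrightarrow> f \<in> borel_measurable M"
  by (simp add: bounded_borel_def)

lemma bounded_borel_const [intro, simp]: "(\<lambda>_. c) \<in> bounded_borel M"
  by (auto simp: bounded_borel_def)

lemma bounded_borel_mult [intro]:
  assumes "f \<in> bounded_borel M" "g \<in> bounded_borel M"
  shows "(\<lambda>x. f x * g x) \<in> bounded_borel M"
proof -
  obtain B C where "\<forall>x\<in>space M. \<bar>f x\<bar> \<le> B" "\<forall>x\<in>space M. \<bar>g x\<bar> \<le> C"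
    using assms by (auto simp: bounded_borel_def)
  then have "\<bar>f x * g x\<bar> \<le> \<bar>B\<bar> * \<bar>C\<bar>" if "x \<in> space M" for x
    unfolding abs_mult using that by (intro mult_mono) force+
  then show ?thesis
    using assms by (intro bounded_borelI[where B = "\<bar>B\<bar> * \<bar>C\<bar>"]) (auto dest!: bounded_borel_measurable)
qed

lemma bounded_borel_diff [intro]:
  assumes "f \<in> bounded_borel M" "g \<in> bounded_borel M"
  shows "(\<lambda>x. f x - g x) \<in> bounded_borel M"
proof -
  obtain B C where "\<forall>x\<in>space M. \<bar>f x\<bar> \<le> B" "\<forall>x\<in>space M. \<bar>g x\<bar> \<le> C"
    using assms by (auto simp: bounded_borel_def)
  then have "\<bar>f x - g x\<bar> \<le> B + C" if "x \<in> space M" for x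
    using that abs_triangle_ineq4[of "f x" "g x"] by fastforce
  then show ?thesis
    using assms by (intro bounded_borelI[where B = "B + C"]) (auto dest!: bounded_borel_measurable)
qed

lemma bounded_borel_comp:
  assumes "f \<in> bounded_borel N" "g \<in> M \<rightarrow>\<^sub>M N"
  shows "(\<lambda>x. f (g x)) \<in> bounded_borel M"
  using assms measurable_space[OF assms(2)]
  by (auto simp: bounded_borel_def intro: measurable_compose)

lemma (in finite_measure) integrable_bounded_borel [intro]:
  "f \<in> bounded_borel M \<Longrightarrow> integrable M f"
  by (auto simp: bounded_borel_def intro!: integrable_const_bound AE_I2)

lemma (in prob_space) bounded_borel_integral:
  assumes h: "h \<in> bounded_borel (N \<Otimes>\<^sub>M M)"
  shows "(\<lambda>x. \<integral>y. h (x, y) \<partial>M) \<in> bounded_borel N"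
proof -
  obtain B where B: "\<And>p. p \<in> space (N \<Otimes>\<^sub>M M) \<Longrightarrow> \<bar>h p\<bar> \<le> B"
    using h by (auto simp: bounded_borel_def)
  show ?thesis
  proof (rule bounded_borelI[where B = B])
    show "(\<lambda>x. \<integral>y. h (x, y) \<partial>M) \<in> borel_measurable N"
      using bounded_borel_measurable[OF h]
      by (intro borel_measurable_lebesgue_integral) (simp add: case_prod_beta')
    fix x assume x: "x \<in> space N"
    have int: "integrable M (\<lambda>y. h (x, y))"
      by (rule integrable_bounded_borel, rule bounded_borel_comp[OF h]) (use x in simp)
    have "\<bar>\<integral>y. h (x, y) \<partial>M\<bar> \<le> (\<integral>y. \<bar>h (x, y)\<bar> \<partial>M)"
      by (rule integral_abs_bound)
    also have "\<dots> \<le> (\<integral>y. B \<partial>M)"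
      using int x B by (intro integral_mono) (auto simp: space_pair_measure)
    finally show "\<bar>\<integral>y. h (x, y) \<partial>M\<bar> \<le> B"
      by (simp add: prob_space)
  qed
qed

lemma bounded_borel_fst: "f \<in> bounded_borel M \<Longrightarrow> (\<lambda>z. f (fst z)) \<in> bounded_borel (M \<Otimes>\<^sub>M N)"
  and bounded_borel_snd: "g \<in> bounded_borel N \<Longrightarrow> (\<lambda>z. g (snd z)) \<in> bounded_borel (M \<Otimes>\<^sub>M N)"
  by (auto intro: bounded_borel_comp)

text \<open>Semidefiniteness is tested by integration against bounded functions instead of on finite
  matrices of values. Symmetry is a separate premise of
  \<open>psd_kernel_Cauchy_Schwarz\<close>.\<close>

definition psd_kernel :: "(real \<times> real \<Rightarrow> real) \<Rightarrow> bool" where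
  "psd_kernel K \<longleftrightarrow> K \<in> bounded_borel unit_square \<and>
     (\<forall>f\<in>bounded_borel unit_lborel. 0 \<le> (\<integral>z. f (fst z) * f (snd z) * K z \<partial>unit_square))"

text \<open>Asking that multiplication preserve semidefiniteness makes closure under products
  immediate, so that in place of the Schur product theorem only the generating kernels have to be
  checked.\<close>

definition schur_multiplier :: "(real \<times> real \<Rightarrow> real) \<Rightarrow> bool" where
  "schur_multiplier L \<longleftrightarrow> (\<forall>K. psd_kernel K \<longrightarrow> psd_kernel (\<lambda>z. K z * L z))"

text \<open>The quadratic form is the square of an integral.\<close>

lemma psd_kernel_one: "psd_kernel (\<lambda>_. 1)"
proof -
  have "(\<integral>z. f (fst z) * f (snd z) \<partial>unit_square) = (\<integral>x. f x \<partial>unit_lborel)\<^sup>2"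
    if "f \<in> bounded_borel unit_lborel" for f
  proof -
    have "integrable unit_square (\<lambda>z. f (fst z) * f (snd z))"
      using that by (intro unit_square.integrable_bounded_borel bounded_borel_mult bounded_borel_fst bounded_borel_snd)
    then have "(\<integral>z. f (fst z) * f (snd z) \<partial>unit_square) = (\<integral>x. \<integral>y. f x * f y \<partial>unit_lborel \<partial>unit_lborel)"
      by (subst unit_square.integral_fst'[symmetric]) simp_all
    then show ?thesis by (simp add: power2_eq_square)
  qed
  then show ?thesis by (auto simp: psd_kernel_def)
qed

lemma schur_multiplier_psd: "schur_multiplier L \<Longrightarrow> psd_kernel L"
  using psd_kernel_one by (auto simp: schur_multiplier_def dest!: spec[of _ "\<lambda>_. 1"])

lemma schur_multiplier_mult:
  "schur_multiplier L \<Longrightarrow> schur_multiplier L' \<Longrightarrow> schur_multiplier (\<lambda>z. L z * L' z)"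
  by (simp add: schur_multiplier_def mult.assoc[symmetric])

lemma schur_multiplier_one: "schur_multiplier (\<lambda>_. 1)"
  by (simp add: schur_multiplier_def)

lemma schur_multiplier_power: "schur_multiplier L \<Longrightarrow> schur_multiplier (\<lambda>z. L z ^ n)"
  by (induction n) (simp_all add: schur_multiplier_one schur_multiplier_mult)

lemma schur_multiplier_prod:
  "(\<And>a. a \<in> A \<Longrightarrow> schur_multiplier (L a)) \<Longrightarrow> schur_multiplier (\<lambda>z. \<Prod>a\<in>A. L a z)"
  by (induction A rule: infinite_finite_induct) (simp_all add: schur_multiplier_one schur_multiplier_mult)

lemma schur_multiplier_const:
  assumes "c \<ge> 0"
  shows "schur_multiplier (\<lambda>_. c)"
  unfolding schur_multiplier_def psd_kernel_def
  using assms by (auto simp: mult.assoc[symmetric])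

text \<open>The factor \<phi> can be absorbed into the test function.\<close>

lemma schur_multiplier_rank_one:
  assumes "\<phi> \<in> bounded_borel unit_lborel"
  shows "schur_multiplier (\<lambda>z. \<phi> (fst z) * \<phi> (snd z))"
  unfolding schur_multiplier_def psd_kernel_def
proof (intro allI impI conjI ballI; elim conjE)
  fix K assume K: "K \<in> bounded_borel unit_square"
    "\<forall>f\<in>bounded_borel unit_lborel. 0 \<le> (\<integral>z. f (fst z) * f (snd z) * K z \<partial>unit_square)"
  show "(\<lambda>z. K z * (\<phi> (fst z) * \<phi> (snd z))) \<in> bounded_borel unit_square"
    using K(1) assms by (intro bounded_borel_mult bounded_borel_fst bounded_borel_snd)
  fix f assume f: "f \<in> bounded_borel unit_lborel"
  have "0 \<le> (\<integral>z. (f (fst z) * \<phi> (fst z)) * (f (snd z) * \<phi> (snd z)) * K z \<partial>unit_square)"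
    using K(2)[rule_format, OF bounded_borel_mult[OF f assms]] .
  then show "0 \<le> (\<integral>z. f (fst z) * f (snd z) * (K z * (\<phi> (fst z) * \<phi> (snd z))) \<partial>unit_square)"
    by (simp add: mult_ac)
qed

text \<open>For fixed y this is a rank-one multiplier with nonnegative weight \<open>w y\<close>;
  Fubini moves the integral over y outside the quadratic form.\<close>

lemma schur_multiplier_integral:
  assumes w: "w \<in> bounded_borel unit_lborel" "\<And>y. y \<in> {0..1} \<Longrightarrow> 0 \<le> w y"
    and \<phi>: "case_prod \<phi> \<in> bounded_borel unit_square"
  shows "schur_multiplier (\<lambda>z. \<integral>y. w y * \<phi> (fst z) y * \<phi> (snd z) y \<partial>unit_lborel)"
  unfolding schur_multiplier_def psd_kernel_def
proof (intro allI impI conjI ballI; elim conjE)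
  interpret triple: pair_prob_space unit_square unit_lborel ..
  fix K assume K: "K \<in> bounded_borel unit_square"
    "\<forall>f\<in>bounded_borel unit_lborel. 0 \<le> (\<integral>z. f (fst z) * f (snd z) * K z \<partial>unit_square)"
  let ?M = "unit_square \<Otimes>\<^sub>M unit_lborel"
  let ?g = "\<lambda>p. w (snd p) * \<phi> (fst (fst p)) (snd p) * \<phi> (snd (fst p)) (snd p)"
  have "(\<lambda>p. \<phi> (fst (fst p)) (snd p)) \<in> bounded_borel ?M"
    using bounded_borel_comp[OF \<phi>, of "\<lambda>p. (fst (fst p), snd p)" ?M] by simp
  moreover have "(\<lambda>p. \<phi> (snd (fst p)) (snd p)) \<in> bounded_borel ?M"
    using bounded_borel_comp[OF \<phi>, of "\<lambda>p. (snd (fst p), snd p)" ?M] by simp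
  ultimately have g: "?g \<in> bounded_borel ?M"
    using w(1) by (intro bounded_borel_mult bounded_borel_snd)
  have L: "(\<lambda>z. \<integral>y. ?g (z, y) \<partial>unit_lborel) \<in> bounded_borel unit_square"
    by (rule unit.bounded_borel_integral[OF g])
  then show "(\<lambda>z. K z * (\<integral>y. w y * \<phi> (fst z) y * \<phi> (snd z) y \<partial>unit_lborel))
      \<in> bounded_borel unit_square"
    using K(1) by (intro bounded_borel_mult) simp_all
  fix f assume f: "f \<in> bounded_borel unit_lborel"
  let ?h = "\<lambda>z. f (fst z) * f (snd z) * K z"
  have h: "?h \<in> bounded_borel unit_square"
    using K(1) f by (intro bounded_borel_mult bounded_borel_fst bounded_borel_snd)
  have "(\<integral>z. ?h z * (\<integral>y. ?g (z, y) \<partial>unit_lborel) \<partial>unit_square) =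
      (\<integral>z. \<integral>y. ?h z * ?g (z, y) \<partial>unit_lborel \<partial>unit_square)"
    by simp
  also have "\<dots> = (\<integral>y. \<integral>z. ?h z * ?g (z, y) \<partial>unit_square \<partial>unit_lborel)"
    using bounded_borel_mult[OF bounded_borel_fst[OF h] g]
    by (intro triple.Fubini_integral[symmetric]) (auto simp: case_prod_beta')
  also have "\<dots> \<ge> 0"
  proof (rule integral_nonneg_AE, rule AE_I2)
    fix y assume y: "y \<in> space unit_lborel"
    have \<phi>y: "(\<lambda>s. \<phi> s y) \<in> bounded_borel unit_lborel"
      using bounded_borel_comp[OF \<phi>, of "\<lambda>s. (s, y)"] y by simp
    have "0 \<le> (\<integral>z. (f (fst z) * \<phi> (fst z) y) * (f (snd z) * \<phi> (snd z) y) * K z \<partial>unit_square)"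
      using K(2)[rule_format, OF bounded_borel_mult[OF f \<phi>y]] .
    then have "0 \<le> w y * (\<integral>z. (f (fst z) * \<phi> (fst z) y) * (f (snd z) * \<phi> (snd z) y) * K z \<partial>unit_square)"
      using w(2) y by (simp add: space_unit_lborel)
    then show "0 \<le> (\<integral>z. ?h z * ?g (z, y) \<partial>unit_square)"
      unfolding integral_mult_right_zero[symmetric] by (simp add: mult_ac)
  qed
  finally show "0 \<le> (\<integral>z. f (fst z) * f (snd z) *
      (K z * (\<integral>y. w y * \<phi> (fst z) y * \<phi> (snd z) y \<partial>unit_lborel)) \<partial>unit_square)"
    by (simp add: mult_ac)
qed

text \<open>Evaluate the quadratic form at \<open>c * f - g\<close>. The inequality is kept linear
  in the three integrals, so that it can be integrated over the remaining coordinates before c is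
  chosen.\<close>

lemma psd_kernel_Cauchy_Schwarz:
  assumes K: "psd_kernel K"
    and sym: "\<And>s t. s \<in> {0..1} \<Longrightarrow> t \<in> {0..1} \<Longrightarrow> K (s, t) = K (t, s)"
    and f: "f \<in> bounded_borel unit_lborel" and g: "g \<in> bounded_borel unit_lborel" and "c > 0"
  shows "2 * (\<integral>z. f (fst z) * g (snd z) * K z \<partial>unit_square) \<le>
    c * (\<integral>z. f (fst z) * f (snd z) * K z \<partial>unit_square) +
    (\<integral>z. g (fst z) * g (snd z) * K z \<partial>unit_square) / c"
proof -
  let ?I = "\<lambda>f g. \<integral>z. f (fst z) * g (snd z) * K z \<partial>unit_square"
  have Kb: "K \<in> bounded_borel unit_square" using K by (simp add: psd_kernel_def)
  have int: "integrable unit_square (\<lambda>z. a (fst z) * b (snd z) * K z)"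
    if "a \<in> bounded_borel unit_lborel" "b \<in> bounded_borel unit_lborel" for a b
    using that Kb
    by (intro unit_square.integrable_bounded_borel bounded_borel_mult bounded_borel_fst bounded_borel_snd)
  \<comment> \<open>Symmetry of K merges the two cross terms.\<close>
  have "?I g f = (\<integral>(x, y). g y * f x * K (y, x) \<partial>unit_square)"
    using unit_square.integral_product_swap[of "\<lambda>z. g (fst z) * f (snd z) * K z"] int[OF g f]
    by (simp add: case_prod_beta')
  also have "\<dots> = ?I f g"
    by (rule Bochner_Integration.integral_cong)
      (auto simp: space_pair_measure space_unit_lborel sym mult_ac)
  finally have swap: "?I g f = ?I f g" .
  define h where "h = (\<lambda>x. c * f x - g x)"
  have "h \<in> bounded_borel unit_lborel"
    unfolding h_def by (intro bounded_borel_diff bounded_borel_mult bounded_borel_const f g)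
  then have "0 \<le> ?I h h" using K by (simp add: psd_kernel_def)
  also have "?I h h = (\<integral>z. c\<^sup>2 * (f (fst z) * f (snd z) * K z) - c * (f (fst z) * g (snd z) * K z)
      - c * (g (fst z) * f (snd z) * K z) + g (fst z) * g (snd z) * K z \<partial>unit_square)"
    by (rule Bochner_Integration.integral_cong) (auto simp: h_def algebra_simps power2_eq_square)
  also have "\<dots> = c\<^sup>2 * ?I f f - c * ?I f g - c * ?I g f + ?I g g"
    using int[OF f f] int[OF f g] int[OF g f] int[OF g g] by simp
  finally show ?thesis
    using \<open>c > 0\<close> unfolding swap by (simp add: field_simps power2_eq_square)
qed

subsection \<open>The folding inequality\<close>

text \<open>A suitable choice of c turns the integrated linear inequalities back into a
  Cauchy-Schwarz bound.\<close>

lemma square_le_mult_if_scaled_le: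
  fixes t p q :: real
  assumes scaled: "\<And>c. c > 0 \<Longrightarrow> 2 * t \<le> c * p + q / c" and "0 \<le> t" "0 \<le> p" "0 \<le> q"
  shows "t\<^sup>2 \<le> p * q"
proof (cases "t = 0")
  case False
  then have "t > 0" using assms(2) by simp
  have "p \<noteq> 0"
  proof
    assume "p = 0"
    \<comment> \<open>For p = 0 the right side tends to 0 as c grows; this c is already large enough
      for a contradiction.\<close>
    have c: "q / t + 1 > 0"
      using \<open>t > 0\<close> assms(4) by (simp add: add_nonneg_pos)
    have "2 * t * (q / t + 1) \<le> q"
      using scaled[OF c] \<open>p = 0\<close> pos_le_divide_eq[OF c] by simp
    moreover have "2 * t * (q / t + 1) = 2 * q + 2 * t"
      using \<open>t > 0\<close> by (simp add: field_simps)
    ultimately show False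
      using \<open>t > 0\<close> assms(4) by simp
  qed
  then have "p > 0" using assms(3) by simp
  \<comment> \<open>With c = t / p the first summand equals t.\<close>
  then show ?thesis
    using scaled[of "t / p"] \<open>t > 0\<close> by (simp add: field_simps power2_eq_square)
qed (use assms in simp)

section \<open>Codegrees and downset weights of a Borel kernel\<close>

locale bounded_kernel =
  fixes W :: "real \<Rightarrow> real \<Rightarrow> real"
  assumes W_borel: "case_prod W \<in> borel_measurable (borel \<Otimes>\<^sub>M borel)"
    and W_nonneg: "0 \<le> W x y" and W_le_one: "W x y \<le> 1"
begin

lemma W_measurable [measurable (raw)]:
  assumes "f \<in> borel_measurable M" "g \<in> borel_measurable M"
  shows "(\<lambda>z. W (f z) (g z)) \<in> borel_measurable M"
  using measurable_compose[OF measurable_Pair[OF assms] W_borel] by simp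

lemma unit_lborel_measurable_id [measurable]: "(\<lambda>y. y) \<in> borel_measurable unit_lborel"
  by (simp add: measurable_restrict_space1)

lemma unit_lborel_measurableD: "f \<in> M \<rightarrow>\<^sub>M unit_lborel \<Longrightarrow> f \<in> borel_measurable M"
  using measurable_compose[OF _ unit_lborel_measurable_id] by simp

lemma component_measurable: "k \<in> I \<Longrightarrow> (\<lambda>x. x k) \<in> borel_measurable (cube I)"
  by (rule unit_lborel_measurableD, rule measurable_component_singleton)

lemma W_bounded_borel: "case_prod W \<in> bounded_borel unit_square"
  using W_nonneg W_le_one
  by (intro bounded_borelI[where B = 1])
    (auto simp: case_prod_beta' intro!: W_measurable unit_lborel_measurableD)

text \<open>This is \<rho>(x_F) for a Borel kernel, formed with the Borel measure on the interval;
  \<open>AE_rho_eq_codegree\<close> links it to \<open>rho\<close>.\<close>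

definition codegree :: "'i set \<Rightarrow> ('i \<Rightarrow> real) \<Rightarrow> real" where
  "codegree F x = (\<integral>y. (\<Prod>k\<in>F. W (x k) y) \<partial>unit_lborel)"

lemma prod_W_bounds: "0 \<le> (\<Prod>k\<in>F. W (x k) y)" "(\<Prod>k\<in>F. W (x k) y) \<le> 1"
  using W_nonneg W_le_one by (auto intro!: prod_nonneg prod_le_1)

lemma prod_W_measurable: "(\<lambda>y. \<Prod>k\<in>F. W (x k) y) \<in> borel_measurable unit_lborel"
  by measurable

lemma prod_W_integrable: "integrable unit_lborel (\<lambda>y. \<Prod>k\<in>F. W (x k) y)"
  by (intro unit.integrable_bounded_borel bounded_borel_unit_range prod_W_measurable prod_W_bounds)

lemma codegree_nonneg: "0 \<le> codegree F x"
  unfolding codegree_def by (intro integral_nonneg_AE AE_I2 prod_W_bounds)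

lemma codegree_le_one: "codegree F x \<le> 1"
proof -
  have "codegree F x \<le> (\<integral>y. 1 \<partial>unit_lborel)"
    unfolding codegree_def by (intro integral_mono prod_W_integrable prod_W_bounds) simp
  then show ?thesis using unit.prob_space by simp
qed

lemma prod_W_measurable_cube:
  assumes "F \<subseteq> I"
  shows "(\<lambda>(x, y). \<Prod>k\<in>F. W (x k) y) \<in> borel_measurable (cube I \<Otimes>\<^sub>M unit_lborel)"
  unfolding case_prod_beta' using assms
  by (intro borel_measurable_prod W_measurable unit_lborel_measurableD
      measurable_compose[OF measurable_fst measurable_component_singleton] measurable_snd) auto

lemma codegree_measurable: "F \<subseteq> I \<Longrightarrow> codegree F \<in> borel_measurable (cube I)"
  unfolding codegree_def[abs_def]
  by (intro unit.borel_measurable_lebesgue_integral prod_W_measurable_cube)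

lemma codegree_cong: "(\<And>k. k \<in> F \<Longrightarrow> x k = x' k) \<Longrightarrow> codegree F x = codegree F x'"
  unfolding codegree_def by simp

lemma codegree_image: "inj_on \<sigma> F \<Longrightarrow> codegree (\<sigma> ` F) x = codegree F (x \<circ> \<sigma>)"
  unfolding codegree_def by (simp add: prod.reindex)

text \<open>This is \<Psi>(x_G) of the overview.\<close>

definition downset_weight :: "(nat \<Rightarrow> nat) \<Rightarrow> 'i set \<Rightarrow> ('i \<Rightarrow> real) \<Rightarrow> real" where
  "downset_weight \<beta> G x = (\<Prod>F\<in>Pow G - {{}}. codegree F x ^ \<beta> (card F))"

lemma downset_weight_nonneg: "0 \<le> downset_weight \<beta> G x"
  unfolding downset_weight_def by (intro prod_nonneg) (simp add: codegree_nonneg)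

lemma downset_weight_le_one: "downset_weight \<beta> G x \<le> 1"
  unfolding downset_weight_def
  by (intro prod_le_1) (simp add: codegree_nonneg codegree_le_one power_le_one)

lemma downset_weight_measurable: "G \<subseteq> I \<Longrightarrow> downset_weight \<beta> G \<in> borel_measurable (cube I)"
  unfolding downset_weight_def[abs_def]
  by (intro borel_measurable_prod borel_measurable_power codegree_measurable) auto

lemma downset_weight_cong:
  "(\<And>k. k \<in> G \<Longrightarrow> x k = x' k) \<Longrightarrow> downset_weight \<beta> G x = downset_weight \<beta> G x'"
  unfolding downset_weight_def
  by (intro prod.cong refl arg_cong[where f = "\<lambda>c. c ^ _"] codegree_cong) auto

text \<open>The transposition maps the nonempty subsets of G bijectively onto those of its image and
  keeps their sizes, on which alone the exponents depend.\<close>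

lemma downset_weight_transposition:
  "downset_weight \<beta> (transposition i j ` G) x = downset_weight \<beta> G (x \<circ> transposition i j)"
proof -
  have "Pow (transposition i j ` G) - {{}} = (`) (transposition i j) ` (Pow G - {{}})"
    by (auto simp: image_Pow_surj[OF refl, symmetric])
  then show ?thesis
    unfolding downset_weight_def
    by (simp add: prod.reindex inj_transpose_image codegree_image)
qed

lemma bounded_borel_downset_weight: "G \<subseteq> I \<Longrightarrow> downset_weight \<beta> G \<in> bounded_borel (cube I)"
  by (intro bounded_borel_unit_range downset_weight_measurable downset_weight_nonneg
      downset_weight_le_one)

lemma measurable_upd:
  assumes "x \<in> space (cube I)" "i \<in> I"
  shows "(\<lambda>s. x(i := s)) \<in> unit_lborel \<rightarrow>\<^sub>M cube I"
  using assms by (intro measurable_cube_updI) auto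

text \<open>For fixed y the integrand is \<open>W s y * W t y\<close> times a nonnegative factor
  from the remaining coordinates, so the codegree is a mixture of rank-one kernels.\<close>

lemma schur_multiplier_codegree:
  assumes "finite F" "i \<in> F" "j \<in> F" "i \<noteq> j"
  shows "schur_multiplier (\<lambda>z. codegree F (x(i := fst z, j := snd z)))"
proof -
  let ?w = "\<lambda>y. \<Prod>k\<in>F - {i, j}. W (x k) y"
  have F: "F = insert i (insert j (F - {i, j}))" using assms by auto
  have "(\<Prod>k\<in>F. W ((x(i := s, j := t)) k) y) = ?w y * W s y * W t y" for s t y
  proof -
    have "(\<Prod>k\<in>F. W ((x(i := s, j := t)) k) y) =
        W s y * (W t y * (\<Prod>k\<in>F - {i, j}. W ((x(i := s, j := t)) k) y))"
      using assms(1,4) by (subst F) simp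
    also have "(\<Prod>k\<in>F - {i, j}. W ((x(i := s, j := t)) k) y) = ?w y"
      by (intro prod.cong) auto
    finally show ?thesis by (simp only: mult_ac)
  qed
  moreover have "?w \<in> bounded_borel unit_lborel"
    by (intro bounded_borel_unit_range prod_W_measurable prod_W_bounds)
  ultimately show ?thesis
    unfolding codegree_def
    using schur_multiplier_integral[of ?w W, OF _ prod_W_bounds(1) W_bounded_borel] by simp
qed

text \<open>Sort the nonempty subsets of G by membership of i and j: those with neither give a
  constant, those with both fall under \<open>schur_multiplier_codegree\<close>, and those with only
  i pair with their mirror images to form \<open>\<phi> s * \<phi> t\<close>.\<close>

lemma schur_multiplier_downset_weight:
  assumes "finite I" "G \<subseteq> I" and x: "x \<in> space (cube I)"
    and ij: "i \<in> I" "j \<in> I" "i \<noteq> j" and bal: "i \<in> G \<longleftrightarrow> j \<in> G"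
  shows "schur_multiplier (\<lambda>z. downset_weight \<beta> G (x(i := fst z, j := snd z)))"
proof (cases "i \<in> G")
  case False
  then have "downset_weight \<beta> G (x(i := fst z, j := snd z)) = downset_weight \<beta> G x" for z
    using bal by (intro downset_weight_cong) auto
  then show ?thesis by (simp add: schur_multiplier_const downset_weight_nonneg)
next
  case True
  then have "i \<in> G" "j \<in> G" using bal by auto
  have "finite G" using assms(1,2) finite_subset by blast
  define P where "P = (\<lambda>a b. {F \<in> Pow G - {{}}. (i \<in> F \<longleftrightarrow> a) \<and> (j \<in> F \<longleftrightarrow> b)})"
  have finP: "finite (P a b)" for a b using \<open>finite G\<close> by (simp add: P_def)
  have Pow: "Pow G - {{}} = P False False \<union> (P True True \<union> (P True False \<union> P False True))"
    by (auto simp: P_def)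
  have disj: "P False False \<inter> (P True True \<union> (P True False \<union> P False True)) = {}"
    "P True True \<inter> (P True False \<union> P False True) = {}" "P True False \<inter> P False True = {}"
    by (auto simp: P_def)
  define c where "c = (\<lambda>F s t. codegree F (x(i := s, j := t)) ^ \<beta> (card F))"
  define \<phi> where "\<phi> = (\<lambda>s. \<Prod>F\<in>P True False. codegree F (x(i := s)) ^ \<beta> (card F))"
  have split: "downset_weight \<beta> G (x(i := s, j := t)) =
      (\<Prod>F\<in>P False False. c F s t) * ((\<Prod>F\<in>P True True. c F s t) *
      ((\<Prod>F\<in>P True False. c F s t) * (\<Prod>F\<in>P False True. c F s t)))" for s t
    unfolding downset_weight_def Pow c_def
    using finP disj by (simp add: prod.union_disjoint)
  have FF: "(\<Prod>F\<in>P False False. c F s t) = (\<Prod>F\<in>P False False. codegree F x ^ \<beta> (card F))" for s t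
    unfolding c_def
    by (intro prod.cong refl arg_cong[where f = "\<lambda>c. c ^ _"] codegree_cong) (auto simp: P_def)
  have TF: "(\<Prod>F\<in>P True False. c F s t) = \<phi> s" for s t
    unfolding c_def \<phi>_def
    by (intro prod.cong refl arg_cong[where f = "\<lambda>c. c ^ _"] codegree_cong) (auto simp: P_def)
  \<comment> \<open>Both i and j belong to G, so the mirror images stay inside G.\<close>
  have img: "P False True = (`) (transposition i j) ` P True False"
  proof -
    have sub: "transposition i j ` F \<in> P b a" if "F \<in> P a b" for F a b
      using that transpose_image_subset[of F G i j] \<open>i \<in> G\<close> \<open>j \<in> G\<close>
      by (auto simp: P_def mem_transpose_image simp del: image_is_empty)
    show ?thesis
      using sub[of _ True False] sub[of _ False True]
      by (auto intro!: image_eqI[where f = "(`) (transposition i j)" and x = "transposition i j ` _"])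
  qed
  have FT: "(\<Prod>F\<in>P False True. c F s t) = \<phi> t" for s t
    unfolding img prod.reindex[OF inj_transpose_image] c_def \<phi>_def comp_def
      codegree_image[OF inj_on_transpose] card_transpose_image
    by (intro prod.cong refl arg_cong[where f = "\<lambda>c. c ^ _"] codegree_cong)
      (auto simp: P_def Transposition.transpose_def)
  have "schur_multiplier (\<lambda>z. \<Prod>F\<in>P True True. c F (fst z) (snd z))"
    unfolding c_def using \<open>finite G\<close> \<open>i \<noteq> j\<close>
    by (intro schur_multiplier_prod schur_multiplier_power schur_multiplier_codegree)
      (auto simp: P_def intro: finite_subset)
  moreover have "\<phi> \<in> bounded_borel unit_lborel"
  proof (rule bounded_borelI[where B = 1])
    show "\<phi> \<in> borel_measurable unit_lborel"
      unfolding \<phi>_def using assms(2)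
      by (intro borel_measurable_prod borel_measurable_power
          measurable_compose[OF measurable_upd[OF x ij(1)] codegree_measurable]) (auto simp: P_def)
    show "\<bar>\<phi> s\<bar> \<le> 1" for s
      unfolding \<phi>_def abs_prod
      by (intro prod_le_1) (simp add: codegree_nonneg codegree_le_one power_le_one)
  qed
  ultimately have "schur_multiplier (\<lambda>z. (\<Prod>F\<in>P False False. codegree F x ^ \<beta> (card F)) *
      ((\<Prod>F\<in>P True True. c F (fst z) (snd z)) * (\<phi> (fst z) * \<phi> (snd z))))"
    by (intro schur_multiplier_mult schur_multiplier_const schur_multiplier_rank_one prod_nonneg)
      (simp_all add: codegree_nonneg)
  then show ?thesis by (simp only: split FF TF FT)
qed

section \<open>The densities t(\<G>) of families and their behaviour under folding\<close>

definition family_density :: "(nat \<Rightarrow> nat) \<Rightarrow> 'i set \<Rightarrow> 'i set set \<Rightarrow> real" where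
  "family_density \<beta> I \<G> = (\<integral>x. (\<Prod>G\<in>\<G>. downset_weight \<beta> G x) \<partial>cube I)"

lemma family_density_nonneg: "0 \<le> family_density \<beta> I \<G>"
  unfolding family_density_def
  by (intro integral_nonneg_AE AE_I2 prod_nonneg) (simp add: downset_weight_nonneg)

lemma family_density_empty: "family_density \<beta> I {} = 1"
  unfolding family_density_def using prob_space.prob_space[OF prob_space_cube] by simp

(* Given the other coordinates, the integrand is f(x_i) g(x_j) K(x_i, x_j) with K positive semidefinite:
   f collects the sets containing only i, g those containing only j. *)
lemma family_density_fold:
  fixes I :: "'i set"
  assumes "finite I" and \<G>: "\<G> \<subseteq> Pow I" and ij: "i \<in> I" "j \<in> I" "i \<noteq> j"
  shows "(family_density \<beta> I \<G>)\<^sup>2 \<le>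
    family_density \<beta> I (fold_family i j \<G>) * family_density \<beta> I (fold_family j i \<G>)"
proof -
  interpret C: prob_space "cube I" by (rule prob_space_cube)
  have "finite \<G>" using assms(1) \<G> finite_subset by blast
  define p where "p = (\<lambda>(\<H> :: 'i set set) x. \<Prod>G\<in>\<H>. downset_weight \<beta> G x)"
  \<comment> \<open>\<open>q\<close> averages over the coordinates i and j only, with the others
    held fixed.\<close>
  define q where "q = (\<lambda>\<H> x. \<integral>z. p \<H> (x(i := fst z, j := snd z)) \<partial>unit_square)"
  have p_bb: "p \<H> \<in> bounded_borel (cube I)" if "\<H> \<subseteq> Pow I" for \<H>
  proof (rule bounded_borelI[where B = 1])
    show "p \<H> \<in> borel_measurable (cube I)"
      unfolding p_def using that by (intro borel_measurable_prod downset_weight_measurable) auto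
    show "\<bar>p \<H> x\<bar> \<le> 1" for x
      unfolding p_def abs_prod
      by (intro prod_le_1) (simp add: downset_weight_nonneg downset_weight_le_one)
  qed
  have dens: "family_density \<beta> I \<H> = (\<integral>x. q \<H> x \<partial>cube I)" if \<H>: "\<H> \<subseteq> Pow I" for \<H>
  proof -
    obtain B where "\<And>x. x \<in> space (cube I) \<Longrightarrow> \<bar>p \<H> x\<bar> \<le> B"
      using p_bb[OF \<H>] by (auto simp: bounded_borel_def)
    then show ?thesis
      using integral_resample2[OF assms(1) ij(1,2) bounded_borel_measurable[OF p_bb[OF \<H>]]]
      unfolding family_density_def q_def p_def by blast
  qed
  have q_int: "integrable (cube I) (q \<H>)" if "\<H> \<subseteq> Pow I" for \<H>
  proof -
    have square: "prob_space unit_square" by unfold_locales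
    have "(\<lambda>(x, z). x(i := fst z, j := snd z)) \<in> cube I \<Otimes>\<^sub>M unit_square \<rightarrow>\<^sub>M cube I"
      unfolding case_prod_beta' using ij(1,2) by (intro measurable_cube_updI) auto
    from prob_space.bounded_borel_integral[OF square bounded_borel_comp[OF p_bb[OF that] this]]
    show ?thesis unfolding q_def by (intro C.integrable_bounded_borel) simp
  qed
  have sub: "fold_family a b \<G> \<subseteq> Pow I" if "a \<in> I" "b \<in> I" for a b
    using \<G> that transpose_image_subset[of _ I a b]
    by (auto simp: fold_family_def balanced_sets_def moved_sets_def)
  have pointwise: "2 * q \<G> x \<le> c * q (fold_family i j \<G>) x + q (fold_family j i \<G>) x / c"
    if x: "x \<in> space (cube I)" and "c > 0" for x c
  proof -
    \<comment> \<open>The bound \<open>i\<close> shadows the fixed one, so \<open>f j i\<close>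
      varies the coordinate j. The other coordinate may keep its old value because the sets in
      question avoid it.\<close>
    define f where "f = (\<lambda>i j s. \<Prod>G\<in>moved_sets i j \<G>. downset_weight \<beta> G (x(i := s)))"
    define K where "K = (\<lambda>z. \<Prod>G\<in>balanced_sets i j \<G>. downset_weight \<beta> G (x(i := fst z, j := snd z)))"
    have f_bb: "f a b \<in> bounded_borel unit_lborel" if "a \<in> I" for a b
    proof (rule bounded_borelI[where B = 1])
      show "f a b \<in> borel_measurable unit_lborel"
        unfolding f_def using \<G>
        by (intro borel_measurable_prod
            measurable_compose[OF measurable_upd[OF x that] downset_weight_measurable])
          (auto simp: moved_sets_def)
      show "\<bar>f a b s\<bar> \<le> 1" for s
        unfolding f_def abs_prod
        by (intro prod_le_1) (simp add: downset_weight_nonneg downset_weight_le_one)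
    qed
    have "schur_multiplier K"
      unfolding K_def using assms x
      by (intro schur_multiplier_prod schur_multiplier_downset_weight[where I = I])
        (auto simp: balanced_sets_def)
    then have psd: "psd_kernel K" by (rule schur_multiplier_psd)
    \<comment> \<open>Exchanging the two values amounts to transposing the coordinates, which leaves
      balanced sets in place.\<close>
    have sym: "K (s, t) = K (t, s)" for s t
    proof -
      have "downset_weight \<beta> G (x(i := s, j := t)) = downset_weight \<beta> G (x(i := t, j := s))"
        if "G \<in> balanced_sets i j \<G>" for G
      proof -
        have "downset_weight \<beta> G (x(i := s, j := t)) =
            downset_weight \<beta> G ((x(i := s, j := t)) \<circ> transposition i j)"
          using that downset_weight_transposition[of \<beta> i j G]
          by (simp add: balanced_sets_def transpose_image_fixed)
        also have "(x(i := s, j := t)) \<circ> transposition i j = x(i := t, j := s)"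
          using ij(3) by (auto simp: fun_eq_iff Transposition.transpose_def)
        finally show ?thesis .
      qed
      then show ?thesis unfolding K_def by simp
    qed
    have moved_i: "(\<Prod>G\<in>moved_sets i j \<G>. downset_weight \<beta> G (x(i := s, j := t))) = f i j s" for s t
      unfolding f_def by (intro prod.cong refl downset_weight_cong) (auto simp: moved_sets_def)
    have moved_j: "(\<Prod>G\<in>moved_sets j i \<G>. downset_weight \<beta> G (x(i := s, j := t))) = f j i t" for s t
      unfolding f_def by (intro prod.cong refl downset_weight_cong) (auto simp: moved_sets_def)
    \<comment> \<open>The mirror images contain j and not i; transposing back evaluates the original
      sets at the value of the coordinate j.\<close>
    have image_i: "(\<Prod>G\<in>(`) (transposition i j) ` moved_sets i j \<G>.
        downset_weight \<beta> G (x(i := s, j := t))) = f i j t" for s t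
      unfolding prod.reindex[OF inj_transpose_image] f_def comp_def downset_weight_transposition
      by (intro prod.cong refl downset_weight_cong)
        (auto simp: moved_sets_def Transposition.transpose_def)
    have image_j: "(\<Prod>G\<in>(`) (transposition j i) ` moved_sets j i \<G>.
        downset_weight \<beta> G (x(i := s, j := t))) = f j i s" for s t
      unfolding prod.reindex[OF inj_transpose_image] f_def comp_def downset_weight_transposition
      by (intro prod.cong refl downset_weight_cong)
        (use ij(3) in \<open>auto simp: moved_sets_def Transposition.transpose_def\<close>)
    have pG: "p \<G> (x(i := s, j := t)) = f i j s * f j i t * K (s, t)" for s t
    proof -
      have "p \<G> (x(i := s, j := t)) = (\<Prod>G\<in>balanced_sets i j \<G> \<union>
          (moved_sets i j \<G> \<union> moved_sets j i \<G>). downset_weight \<beta> G (x(i := s, j := t)))"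
        unfolding p_def family_decomposition ..
      also have "\<dots> = K (s, t) * (f i j s * f j i t)"
        using \<open>finite \<G>\<close> moved_i moved_j
        by (simp add: prod.union_disjoint family_decomposition(1,2) K_def)
      finally show ?thesis by simp
    qed
    have pij: "p (fold_family i j \<G>) (x(i := s, j := t)) = f i j s * f i j t * K (s, t)" for s t
      unfolding p_def fold_family_def
      using \<open>finite \<G>\<close> moved_i image_i
      by (simp add: prod.union_disjoint fold_family_disjoint K_def)
    have pji: "p (fold_family j i \<G>) (x(i := s, j := t)) = f j i s * f j i t * K (s, t)" for s t
      unfolding p_def fold_family_def
      using \<open>finite \<G>\<close> moved_j image_j fold_family_disjoint[of j i \<G>]
        family_decomposition(4)[where i = i and j = j and \<G> = \<G>]
      by (simp add: prod.union_disjoint K_def)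
    show ?thesis
      using psd_kernel_Cauchy_Schwarz[OF psd sym f_bb[OF ij(1)] f_bb[OF ij(2)] \<open>c > 0\<close>]
      unfolding q_def pG pij pji by simp
  qed
  \<comment> \<open>Integrate the pointwise inequality over the remaining coordinates with c fixed;
    c is eliminated only afterwards.\<close>
  have "2 * family_density \<beta> I \<G> \<le>
      c * family_density \<beta> I (fold_family i j \<G>) + family_density \<beta> I (fold_family j i \<G>) / c"
    if "c > 0" for c
  proof -
    have "(\<integral>x. 2 * q \<G> x \<partial>cube I) \<le>
        (\<integral>x. c * q (fold_family i j \<G>) x + q (fold_family j i \<G>) x / c \<partial>cube I)"
      using q_int[OF \<G>] q_int[OF sub] ij pointwise that
      by (intro integral_mono) auto
    also have "\<dots> = c * (\<integral>x. q (fold_family i j \<G>) x \<partial>cube I) +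
        (\<integral>x. q (fold_family j i \<G>) x \<partial>cube I) / c"
      using q_int[OF sub] ij by simp
    finally show ?thesis
      using dens[OF \<G>] dens[OF sub] ij by simp
  qed
  then show ?thesis
    by (intro square_le_mult_if_scaled_le family_density_nonneg)
qed

lemma single_downset_density_le:
  assumes "finite I" "G \<subseteq> I"
  shows "family_density \<beta> I {G} ^ (card I choose card G) \<le>
    family_density \<beta> I {G'. G' \<subseteq> I \<and> card G' = card G}"
proof -
  have "family_density \<beta> I {G} ^ card {G'. G' \<subseteq> I \<and> card G' = card G} \<le>
      family_density \<beta> I {G'. G' \<subseteq> I \<and> card G' = card G}"
    using assms
    by (intro single_edge_le_complete[OF assms(1) refl] family_density_nonneg
        family_density_empty family_density_fold) auto
  then show ?thesis using n_subsets[OF assms(1), of "card G"] by simp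
qed

end

subsection \<open>A single r-set\<close>

(* AM-GM for the summands with their multiplicities: their product is 1. *)
lemma weighted_AM_GM:
  fixes a :: "'a \<Rightarrow> real" and n :: "'a \<Rightarrow> nat"
  assumes "finite A" "\<And>i. i \<in> A \<Longrightarrow> 0 < a i" "0 < b" "0 < p"
  shows "real ((\<Sum>i\<in>A. n i) + m + 1) \<le>
    (\<Prod>i\<in>A. a i ^ n i) * b ^ m / p ^ ((\<Sum>i\<in>A. n i) + m) + (\<Sum>i\<in>A. n i * (p / a i)) + m * (p / b)"
proof -
  \<comment> \<open>When this bound is added up over all summands with multiplicity, the logarithms
    cancel.\<close>
  have ln_le: "1 + ln t \<le> t" if "t > 0" for t :: real
    using ln_le_minus_one[OF that] by simp
  let ?U = "(\<Prod>i\<in>A. a i ^ n i) * b ^ m / p ^ ((\<Sum>i\<in>A. n i) + m)"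
  have pos: "(\<Prod>i\<in>A. a i ^ n i) > 0" using assms by (auto intro!: prod_pos)
  have "ln (\<Prod>i\<in>A. a i ^ n i) = (\<Sum>i\<in>A. n i * ln (a i))"
  proof -
    have "a i \<noteq> 0" if "i \<in> A" for i using assms(2)[OF that] by simp
    then have "ln (\<Prod>i\<in>A. a i ^ n i) = (\<Sum>i\<in>A. ln (a i ^ n i))"
      using assms(1) by (intro ln_prod) simp_all
    also have "\<dots> = (\<Sum>i\<in>A. n i * ln (a i))"
      using assms by (intro sum.cong) (simp_all add: ln_realpow)
    finally show ?thesis .
  qed
  moreover define X where "X = (\<Prod>i\<in>A. a i ^ n i)"
  ultimately have "ln X = (\<Sum>i\<in>A. n i * ln (a i))" by simp
  then have "ln ?U = (\<Sum>i\<in>A. n i * ln (a i)) + m * ln b - ((\<Sum>i\<in>A. n i) + m) * ln p"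
    using assms pos unfolding X_def[symmetric] by (simp add: ln_div ln_mult ln_realpow)
  moreover have "?U > 0" using assms pos by simp
  ultimately have U: "1 + ((\<Sum>i\<in>A. n i * ln (a i)) + m * ln b - ((\<Sum>i\<in>A. n i) + m) * ln p) \<le> ?U"
    using ln_le by metis
  have "(\<Sum>i\<in>A. n i * (1 + ln p - ln (a i))) \<le> (\<Sum>i\<in>A. n i * (p / a i))"
  proof (intro sum_mono mult_left_mono)
    fix i assume "i \<in> A"
    then have "a i > 0" using assms(2) by blast
    then show "1 + ln p - ln (a i) \<le> p / a i"
      using ln_le[of "p / a i"] assms(4) by (simp add: ln_div)
  qed simp
  moreover have "(\<Sum>i\<in>A. n i * (1 + ln p - ln (a i))) =
      (\<Sum>i\<in>A. n i) * (1 + ln p) - (\<Sum>i\<in>A. n i * ln (a i))"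
    by (simp add: algebra_simps sum.distrib sum_subtractf sum_distrib_left sum_distrib_right)
  moreover have "m * (1 + ln p - ln b) \<le> m * (p / b)"
    using ln_le[of "p / b"] assms by (intro mult_left_mono) (simp_all add: ln_div)
  ultimately show ?thesis
    using U by (simp add: algebra_simps)
qed

section \<open>Degrees, and integrals over independent neighbours\<close>

context bounded_kernel
begin

text \<open>The degree of the vertex y.\<close>

definition marginal :: "real \<Rightarrow> real" where
  "marginal y = (\<integral>s. W s y \<partial>unit_lborel)"

text \<open>The edge density, identified as such in \<open>edge_density_eq_mean\<close>.\<close>

definition mean :: real where
  "mean = (\<integral>y. marginal y \<partial>unit_lborel)"

lemma W_unit_borel: "case_prod W \<in> borel_measurable unit_square"
  by (rule bounded_borel_measurable[OF W_bounded_borel])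

lemma W_section_integrable: "integrable unit_lborel (\<lambda>s. W s y)"
  by (intro unit.integrable_bounded_borel bounded_borel_unit_range W_nonneg W_le_one) measurable

lemma marginal_nonneg: "0 \<le> marginal y"
  unfolding marginal_def by (intro integral_nonneg_AE AE_I2 W_nonneg)

lemma marginal_le_one: "marginal y \<le> 1"
proof -
  have "marginal y \<le> (\<integral>s. 1 \<partial>unit_lborel)"
    unfolding marginal_def by (intro integral_mono W_section_integrable W_le_one) simp
  then show ?thesis using unit.prob_space by simp
qed

lemma marginal_measurable [measurable]: "marginal \<in> borel_measurable unit_lborel"
proof -
  have "(\<lambda>(y, s). W s y) \<in> borel_measurable unit_square"
    using measurable_compose[OF measurable_pair_swap' W_unit_borel] by (simp add: case_prod_beta')
  then show ?thesis
    unfolding marginal_def[abs_def] by (rule unit.borel_measurable_lebesgue_integral)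
qed

lemma marginal_integrable: "integrable unit_lborel marginal"
  by (intro unit.integrable_bounded_borel bounded_borel_unit_range marginal_measurable
      marginal_nonneg marginal_le_one)

lemma mean_nonneg: "0 \<le> mean"
  unfolding mean_def by (intro integral_nonneg_AE AE_I2 marginal_nonneg)

text \<open>Resampling the coordinates in S one at a time integrates each factor to the degree of y,
  since g ignores these coordinates.\<close>

lemma nn_integral_cube_prod_W:
  fixes I :: "'i set"
  assumes "finite I" "S \<subseteq> I" "y \<in> {0..1}"
    and g: "g \<in> borel_measurable (cube I)" "\<And>x. 0 \<le> g x"
    and indep: "\<And>x k s. k \<in> S \<Longrightarrow> g (x(k := s)) = g x"
  shows "(\<integral>\<^sup>+x. ennreal (g x * (\<Prod>k\<in>S. W (x k) y)) \<partial>cube I) =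
    (\<integral>\<^sup>+x. ennreal (g x) \<partial>cube I) * ennreal (marginal y ^ card S)"
proof -
  have "finite S" using assms(1,2) finite_subset by blast
  then show ?thesis using assms(2) indep
  proof (induction S rule: finite_induct)
    case (insert k S)
    let ?h = "\<lambda>x. g x * (\<Prod>l\<in>S. W (x l) y)"
    have pm: "(\<lambda>x. \<Prod>l\<in>T. W (x l) y) \<in> borel_measurable (cube I)" if "T \<subseteq> I" for T
      using that
      by (intro borel_measurable_prod W_measurable component_measurable borel_measurable_const) auto
    have h: "?h \<in> borel_measurable (cube I)" "\<And>x. 0 \<le> ?h x"
      using pm[of S] g insert.prems by (auto intro!: mult_nonneg_nonneg prod_W_bounds)
    have "(\<integral>\<^sup>+x. ennreal (g x * (\<Prod>l\<in>insert k S. W (x l) y)) \<partial>cube I) =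
        (\<integral>\<^sup>+x. \<integral>\<^sup>+s. ennreal (g (x(k := s)) * (\<Prod>l\<in>insert k S. W ((x(k := s)) l) y))
          \<partial>unit_lborel \<partial>cube I)"
      using insert.prems pm[of "insert k S"] g(1) by (intro nn_integral_resample[OF assms(1)]) auto
    also have "\<dots> = (\<integral>\<^sup>+x. \<integral>\<^sup>+s. ennreal (?h x) * ennreal (W s y) \<partial>unit_lborel \<partial>cube I)"
    proof (intro nn_integral_cong)
      fix x s
      have g_upd: "g (x(k := s)) = g x" by (rule insert.prems(2)) simp
      have "(\<Prod>l\<in>insert k S. W ((x(k := s)) l) y) = W s y * (\<Prod>l\<in>S. W (x l) y)"
        using insert.hyps by (auto intro!: arg_cong2[where f = "(*)"] prod.cong)
      then show "ennreal (g (x(k := s)) * (\<Prod>l\<in>insert k S. W ((x(k := s)) l) y)) =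
          ennreal (?h x) * ennreal (W s y)"
        using h(2)[of x] W_nonneg[of s y]
        by (simp add: g_upd ennreal_mult[symmetric] mult_ac del: fun_upd_apply)
    qed
    also have "\<dots> = (\<integral>\<^sup>+x. ennreal (?h x) * ennreal (marginal y) \<partial>cube I)"
    proof (intro nn_integral_cong)
      fix x
      have "(\<integral>\<^sup>+s. ennreal (W s y) \<partial>unit_lborel) = ennreal (marginal y)"
        unfolding marginal_def
        by (intro nn_integral_eq_integral W_section_integrable AE_I2 W_nonneg)
      then show "(\<integral>\<^sup>+s. ennreal (?h x) * ennreal (W s y) \<partial>unit_lborel) =
          ennreal (?h x) * ennreal (marginal y)"
        by (subst nn_integral_cmult) simp_all
    qed
    also have "\<dots> = (\<integral>\<^sup>+x. ennreal (?h x) \<partial>cube I) * ennreal (marginal y)"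
      using h(1) by (intro nn_integral_multc) simp
    also have "(\<integral>\<^sup>+x. ennreal (?h x) \<partial>cube I) =
        (\<integral>\<^sup>+x. ennreal (g x) \<partial>cube I) * ennreal (marginal y ^ card S)"
      using insert by simp
    finally show ?case
      using insert.hyps marginal_nonneg by (simp add: ennreal_mult mult_ac)
  qed simp
qed

text \<open>The value is 1 unless the codegree vanishes, where division by zero yields 0; hence only
  an inequality.\<close>

lemma nn_integral_W_prod_over_codegree:
  "(\<integral>\<^sup>+y. ennreal ((\<Prod>k\<in>F. W (x k) y) / codegree F x) \<partial>unit_lborel) \<le> 1"
proof -
  have "(\<integral>\<^sup>+y. ennreal ((\<Prod>k\<in>F. W (x k) y) / codegree F x) \<partial>unit_lborel) =
      ennreal (\<integral>y. (\<Prod>k\<in>F. W (x k) y) / codegree F x \<partial>unit_lborel)"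
    by (intro nn_integral_eq_integral integrable_divide prod_W_integrable AE_I2
        divide_nonneg_nonneg prod_W_bounds codegree_nonneg)
  also have "\<dots> = ennreal (codegree F x / codegree F x)"
    by (simp add: codegree_def)
  also have "\<dots> \<le> 1" by simp
  finally show ?thesis .
qed

text \<open>If the codegree of F vanishes, the product over F is zero for almost every y, and so is
  the product over the larger set G. This supplies the positivity that the AM-GM inequality
  requires.\<close>

lemma AE_codegree_pos:
  assumes "finite G"
  shows "AE y in unit_lborel. 0 < (\<Prod>k\<in>G. W (x k) y) \<longrightarrow> (\<forall>F\<in>Pow G. 0 < codegree F x)"
proof -
  have "AE y in unit_lborel. 0 < (\<Prod>k\<in>G. W (x k) y) \<longrightarrow> 0 < codegree F x"
    if "F \<in> Pow G" for F
  proof (cases "codegree F x = 0")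
    case True
    then have "AE y in unit_lborel. (\<Prod>k\<in>F. W (x k) y) = 0"
      unfolding codegree_def
      by (subst (asm) integral_nonneg_eq_0_iff_AE[OF prod_W_integrable AE_I2[OF prod_W_bounds(1)]])
    then show ?thesis
    proof eventually_elim
      case (elim y)
      moreover have "finite F" using that assms finite_subset by auto
      ultimately obtain k where "k \<in> F" "W (x k) y = 0" by (auto simp: prod_zero_iff)
      then have "(\<Prod>k\<in>G. W (x k) y) = 0"
        using that assms by (auto intro: prod_zero)
      then show ?case by simp
    qed
  next
    case False
    then show ?thesis using codegree_nonneg[of F x] by simp
  qed
  then have "AE y in unit_lborel. \<forall>F\<in>Pow G. 0 < (\<Prod>k\<in>G. W (x k) y) \<longrightarrow> 0 < codegree F x"
    using assms by (intro AE_finite_allI) auto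
  then show ?thesis by eventually_elim blast
qed

(* With p the mean and d(y) the marginal at y, the pairs (x, y) are drawn with the density
   q(x,y) = W(x_1,y)...W(x_r,y) d(y)^(1-r) / p. Under q the expectations of d(y)^(|F|-1) / rho(x_F) and of
   1 / d(y) are at most 1/p, and
   the integrand is p q(x,y) times a product of the inverses of these quantities. *)
lemma single_downset_density_ge:
  fixes I :: "'i set"
  assumes "finite I" "G \<subseteq> I" "G \<noteq> {}" and \<beta>: "\<beta> (card G) > 0"
  shows "mean ^ (\<Sum>F\<in>Pow G - {{}}. card F * \<beta> (card F)) \<le> family_density \<beta> I {G}"
proof (cases "mean = 0")
  case True
  have fin: "finite G" using assms(1,2) finite_subset by blast
  \<comment> \<open>The summand at G makes the exponent positive, so the left side is 0.\<close>
  then have "card G * \<beta> (card G) \<le> (\<Sum>F\<in>Pow G - {{}}. card F * \<beta> (card F))"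
    using assms(3) by (intro member_le_sum[where f = "\<lambda>F. card F * \<beta> (card F)"]) auto
  moreover have "card G * \<beta> (card G) > 0" using \<beta> assms(3) fin by (simp add: card_gt_0_iff)
  ultimately have "0 < (\<Sum>F\<in>Pow G - {{}}. card F * \<beta> (card F))" by linarith
  from zero_power[OF this] show ?thesis unfolding True using family_density_nonneg by metis
next
  case False
  then have p: "mean > 0" using mean_nonneg by simp
  interpret C: prob_space "cube I" by (rule prob_space_cube)
  interpret Q: pair_prob_space "cube I" unit_lborel ..
  let ?Q = "cube I \<Otimes>\<^sub>M unit_lborel"
  have fin: "finite G" using assms(1,2) finite_subset by blast
  define r where "r = card G"
  define P where "P = Pow G - {{}}"
  have P: "finite P" "G \<in> P" using fin assms(3) by (auto simp: P_def)
  have P_sub: "F \<subseteq> G" "finite F" "1 \<le> card F" "card F \<le> r" if "F \<in> P" for F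
    using that fin finite_subset[of F G] card_mono[of G F]
    by (auto simp: P_def r_def Suc_le_eq card_gt_0_iff)
  \<comment> \<open>One factor \<rho>(x_G) is set aside: it will arise from integrating the product
    of all \<open>W (x k) y\<close> over y.\<close>
  define b where "b = (\<lambda>F. \<beta> (card F) - (if F = G then 1 else 0))"
  have b: "\<beta> (card F) = b F + (if F = G then 1 else 0)" for F
    using \<beta> by (auto simp: b_def)
  \<comment> \<open>The total power of d(y) to be cancelled: |F| - 1 for each codegree with
    multiplicity \<open>b F\<close>, and r - 1 from the density q.\<close>
  define m where "m = (\<Sum>F\<in>P. b F * (card F - 1)) + (r - 1)"
  define e where "e = (\<Sum>F\<in>P. card F * \<beta> (card F))"
  \<comment> \<open>e is the number of summands in \<open>weighted_AM_GM\<close>, counted with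
    multiplicity.\<close>
  have e_eq: "e = (\<Sum>F\<in>P. b F) + m + 1"
  proof -
    have "e = (\<Sum>F\<in>P. b F + b F * (card F - 1) + (if F = G then r else 0))"
      unfolding e_def
    proof (intro sum.cong refl)
      fix F assume "F \<in> P"
      then obtain c where "card F = Suc c" using P_sub(3) by (metis Suc_le_D One_nat_def)
      then show "card F * \<beta> (card F) = b F + b F * (card F - 1) + (if F = G then r else 0)"
        using b[of F] by (cases "F = G") (simp_all add: r_def)
    qed
    then show ?thesis
      using P P_sub(3)[OF P(2)] by (simp add: sum.distrib m_def r_def)
  qed
  define w where "w = (\<lambda>F (x :: 'i \<Rightarrow> real) y. \<Prod>k\<in>F. W (x k) y)"
  have w_nonneg: "0 \<le> w F x y" for F and x :: "'i \<Rightarrow> real" and y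
    by (simp add: w_def prod_W_bounds)
  have w_meas: "(\<lambda>z. w F (fst z) (snd z)) \<in> borel_measurable ?Q" if "F \<subseteq> G" for F
    using prod_W_measurable_cube[of F I] that assms(2) by (simp add: w_def case_prod_beta')
  have w_meas1: "(\<lambda>x. w F x y) \<in> borel_measurable (cube I)" if "F \<subseteq> G" for F y
    unfolding w_def using that assms(2)
    by (intro borel_measurable_prod W_measurable component_measurable borel_measurable_const) auto
  have c_meas: "codegree F \<in> borel_measurable (cube I)" if "F \<subseteq> G" for F
    by (rule codegree_measurable[OF subset_trans[OF that assms(2)]])
  have c_meas': "(\<lambda>z. codegree F (fst z)) \<in> borel_measurable ?Q" if "F \<subseteq> G" for F
    by (rule measurable_compose[OF measurable_fst c_meas[OF that]])
  have d_meas': "(\<lambda>z. marginal (snd z)) \<in> borel_measurable ?Q"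
    by measurable
  (* Not cancelled to d(y)^(1-r): in this form q vanishes where d(y) = 0, also for r = 1. *)
  define q where "q = (\<lambda>x y. w G x y * marginal y / (mean * marginal y ^ r))"
  \<comment> \<open>Where nothing vanishes, \<open>T F\<close>, \<open>D\<close> and
    \<open>E\<close> are q times the summands of the AM-GM inequality: p d(y)^(|F|-1) / \<rho>(x_F),
    p / d(y), and the product that compensates them.\<close>
  define T where "T = (\<lambda>F x y. w G x y * marginal y ^ card F / (marginal y ^ r * codegree F x))"
  define D where "D = (\<lambda>x y. w G x y / marginal y ^ r)"
  define \<Phi> where "\<Phi> = (\<lambda>x. \<Prod>F\<in>P. codegree F x ^ b F)"
  define E where "E = (\<lambda>x y. w G x y * \<Phi> x / mean ^ e)"
  note meas_intros = borel_measurable_times borel_measurable_divide borel_measurable_power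
    borel_measurable_prod borel_measurable_const w_meas[OF subset_refl] d_meas' c_meas'[OF P_sub(1)]
  have meas [measurable]:
    "(\<lambda>z. q (fst z) (snd z)) \<in> borel_measurable ?Q"
    "(\<lambda>z. D (fst z) (snd z)) \<in> borel_measurable ?Q"
    "(\<lambda>z. E (fst z) (snd z)) \<in> borel_measurable ?Q"
    unfolding q_def D_def E_def \<Phi>_def by (intro meas_intros; assumption)+
  have T_meas: "(\<lambda>z. T F (fst z) (snd z)) \<in> borel_measurable ?Q" if "F \<in> P" for F
    unfolding T_def by (intro meas_intros that)
  have nonneg: "0 \<le> q x y" "0 \<le> T F x y" "0 \<le> D x y" "0 \<le> E x y" for x y F
    unfolding q_def T_def D_def E_def \<Phi>_def
    by (intro divide_nonneg_nonneg mult_nonneg_nonneg zero_le_power prod_nonneg w_nonneg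
        marginal_nonneg mean_nonneg codegree_nonneg)+
  have iterate: "(\<integral>\<^sup>+z. ennreal (f (fst z) (snd z)) \<partial>?Q) =
      (\<integral>\<^sup>+x. \<integral>\<^sup>+y. ennreal (f x y) \<partial>unit_lborel \<partial>cube I)"
    "(\<integral>\<^sup>+z. ennreal (f (fst z) (snd z)) \<partial>?Q) =
      (\<integral>\<^sup>+y. \<integral>\<^sup>+x. ennreal (f x y) \<partial>cube I \<partial>unit_lborel)"
    if "(\<lambda>z. f (fst z) (snd z)) \<in> borel_measurable ?Q" for f
  proof -
    have f: "(\<lambda>z. ennreal (f (fst z) (snd z))) \<in> borel_measurable ?Q"
      using that by (rule measurable_compose[OF _ measurable_ennreal])
    show "(\<integral>\<^sup>+z. ennreal (f (fst z) (snd z)) \<partial>?Q) =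
        (\<integral>\<^sup>+x. \<integral>\<^sup>+y. ennreal (f x y) \<partial>unit_lborel \<partial>cube I)"
      using unit.nn_integral_fst[OF f] by (simp only: fst_conv snd_conv)
    show "(\<integral>\<^sup>+z. ennreal (f (fst z) (snd z)) \<partial>?Q) =
        (\<integral>\<^sup>+y. \<integral>\<^sup>+x. ennreal (f x y) \<partial>cube I \<partial>unit_lborel)"
      using Q.nn_integral_snd[OF f] by (simp only: fst_conv snd_conv)
  qed
  \<comment> \<open>Integrating over x first leaves \<open>marginal y / mean\<close>, the density of
    a vertex chosen proportionally to its degree.\<close>
  have q_total: "(\<integral>\<^sup>+z. ennreal (q (fst z) (snd z)) \<partial>?Q) = 1"
  proof -
    have "(\<integral>\<^sup>+x. ennreal (q x y) \<partial>cube I) = ennreal (marginal y / mean)" if y: "y \<in> {0..1}" for y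
    proof -
      let ?c = "marginal y / (mean * marginal y ^ r)"
      have "(\<integral>\<^sup>+x. ennreal (q x y) \<partial>cube I) = (\<integral>\<^sup>+x. ennreal (?c * w G x y) \<partial>cube I)"
        by (simp add: q_def mult.commute)
      also have "\<dots> = (\<integral>\<^sup>+x. ennreal ?c \<partial>cube I) * ennreal (marginal y ^ r)"
        unfolding w_def r_def using mean_nonneg marginal_nonneg
        by (intro nn_integral_cube_prod_W[OF assms(1,2) y]) auto
      also have "\<dots> = ennreal (?c * marginal y ^ r)"
        using mean_nonneg marginal_nonneg C.emeasure_space_1 by (simp add: ennreal_mult[symmetric])
      also have "?c * marginal y ^ r = marginal y / mean"
        using p by (cases "marginal y = 0") (auto simp: field_simps)
      finally show ?thesis .
    qed
    then have "(\<integral>\<^sup>+z. ennreal (q (fst z) (snd z)) \<partial>?Q) =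
        (\<integral>\<^sup>+y. ennreal (marginal y / mean) \<partial>unit_lborel)"
      by (subst iterate(2)[OF meas(1)], intro nn_integral_cong) (simp add: space_unit_lborel)
    also have "\<dots> = ennreal (\<integral>y. marginal y / mean \<partial>unit_lborel)"
      using mean_nonneg marginal_nonneg
      by (intro nn_integral_eq_integral integrable_divide marginal_integrable AE_I2) simp
    also have "\<dots> = 1" using p by (simp add: mean_def)
    finally show ?thesis .
  qed
  have D_total: "(\<integral>\<^sup>+z. ennreal (D (fst z) (snd z)) \<partial>?Q) \<le> 1"
  proof -
    have "(\<integral>\<^sup>+x. ennreal (D x y) \<partial>cube I) \<le> 1" if y: "y \<in> {0..1}" for y
    proof -
      let ?c = "1 / marginal y ^ r"
      have "(\<integral>\<^sup>+x. ennreal (D x y) \<partial>cube I) = (\<integral>\<^sup>+x. ennreal (?c * w G x y) \<partial>cube I)"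
        by (simp add: D_def)
      also have "\<dots> = (\<integral>\<^sup>+x. ennreal ?c \<partial>cube I) * ennreal (marginal y ^ r)"
        unfolding w_def r_def using marginal_nonneg
        by (intro nn_integral_cube_prod_W[OF assms(1,2) y]) auto
      also have "\<dots> = ennreal (?c * marginal y ^ r)"
        using marginal_nonneg C.emeasure_space_1 by (simp add: ennreal_mult[symmetric])
      also have "\<dots> \<le> 1" by simp
      finally show ?thesis .
    qed
    then have "(\<integral>\<^sup>+z. ennreal (D (fst z) (snd z)) \<partial>?Q) \<le> (\<integral>\<^sup>+y. 1 \<partial>unit_lborel)"
      by (subst iterate(2)[OF meas(2)], intro nn_integral_mono) (simp add: space_unit_lborel)
    also have "\<dots> = 1"
      using unit.emeasure_space_1 by (simp add: space_unit_lborel)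
    finally show ?thesis .
  qed
  \<comment> \<open>Integrating out the coordinates in \<open>G - F\<close> cancels all powers of
    d(y); what remains is integrated over y first.\<close>
  have T_total: "(\<integral>\<^sup>+z. ennreal (T F (fst z) (snd z)) \<partial>?Q) \<le> 1" if F: "F \<in> P" for F
  proof -
    note FG = P_sub[OF F]
    let ?v = "\<lambda>x y. w F x y / codegree F x"
    have v_meas: "(\<lambda>z. ?v (fst z) (snd z)) \<in> borel_measurable ?Q"
      using w_meas[OF FG(1)] c_meas'[OF FG(1)] by (rule borel_measurable_divide)
    have "(\<integral>\<^sup>+x. ennreal (T F x y) \<partial>cube I) \<le> (\<integral>\<^sup>+x. ennreal (?v x y) \<partial>cube I)"
      if y: "y \<in> {0..1}" for y
    proof -
      define c where "c = marginal y ^ card F / marginal y ^ r"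
      have c: "c \<ge> 0" by (simp add: c_def marginal_nonneg)
      have "w G x y = w F x y * w (G - F) x y" for x
        unfolding w_def using fin FG(1) prod.subset_diff[of F G] by (simp add: mult.commute)
      then have "T F x y = c * ?v x y * w (G - F) x y" for x
        by (simp add: T_def c_def)
      then have "(\<integral>\<^sup>+x. ennreal (T F x y) \<partial>cube I) =
          (\<integral>\<^sup>+x. ennreal (c * ?v x y * (\<Prod>k\<in>G - F. W (x k) y)) \<partial>cube I)"
        by (simp add: w_def)
      also have "\<dots> = (\<integral>\<^sup>+x. ennreal (c * ?v x y) \<partial>cube I) * ennreal (marginal y ^ card (G - F))"
      proof (rule nn_integral_cube_prod_W[OF assms(1) _ y])
        show "(\<lambda>x. c * ?v x y) \<in> borel_measurable (cube I)"
          using w_meas1[OF FG(1)] c_meas[OF FG(1)] by simp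
        show "c * ?v (x(k := s)) y = c * ?v x y" if "k \<in> G - F" for x k s
        proof -
          have "codegree F (x(k := s)) = codegree F x" "w F (x(k := s)) y = w F x y"
            unfolding w_def using that by (intro codegree_cong prod.cong; auto)+
          then show ?thesis by (simp only:)
        qed
        show "0 \<le> c * ?v x y" for x
          by (intro mult_nonneg_nonneg divide_nonneg_nonneg c w_nonneg codegree_nonneg)
      qed (use assms(2) in blast)
      also have "\<dots> = (\<integral>\<^sup>+x. ennreal (c * ?v x y) * ennreal (marginal y ^ card (G - F)) \<partial>cube I)"
        using w_meas1[OF FG(1)] c_meas[OF FG(1)] by (subst nn_integral_multc) simp_all
      also have "\<dots> \<le> (\<integral>\<^sup>+x. ennreal (?v x y) \<partial>cube I)"
      proof (intro nn_integral_mono)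
        fix x
        have "card F + card (G - F) = r"
          using fin FG by (simp add: card_Diff_subset r_def)
        then have "c * marginal y ^ card (G - F) = marginal y ^ r / marginal y ^ r"
          by (simp add: c_def power_add[symmetric])
        also have "\<dots> \<le> 1" by simp
        finally have "c * marginal y ^ card (G - F) * ?v x y \<le> 1 * ?v x y"
          by (intro mult_right_mono divide_nonneg_nonneg w_nonneg codegree_nonneg)
        moreover have "ennreal (c * ?v x y) * ennreal (marginal y ^ card (G - F)) =
            ennreal (c * ?v x y * marginal y ^ card (G - F))"
          by (intro ennreal_mult[symmetric] mult_nonneg_nonneg divide_nonneg_nonneg zero_le_power
              c w_nonneg codegree_nonneg marginal_nonneg)
        ultimately show "ennreal (c * ?v x y) * ennreal (marginal y ^ card (G - F)) \<le> ennreal (?v x y)"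
          by (simp only: ennreal_leI mult_ac mult_1)
      qed
      finally show ?thesis .
    qed
    then have "(\<integral>\<^sup>+z. ennreal (T F (fst z) (snd z)) \<partial>?Q) \<le>
        (\<integral>\<^sup>+y. \<integral>\<^sup>+x. ennreal (?v x y) \<partial>cube I \<partial>unit_lborel)"
      by (subst iterate(2)[OF T_meas[OF F]], rule nn_integral_mono) (simp add: space_unit_lborel)
    also have "\<dots> = (\<integral>\<^sup>+x. \<integral>\<^sup>+y. ennreal (?v x y) \<partial>unit_lborel \<partial>cube I)"
      using iterate[OF v_meas] by simp
    also have "\<dots> \<le> (\<integral>\<^sup>+x. 1 \<partial>cube I)"
      unfolding w_def by (intro nn_integral_mono nn_integral_W_prod_over_codegree)
    also have "\<dots> = 1" using C.emeasure_space_1 by simp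
    finally show ?thesis .
  qed
  \<comment> \<open>Integrating over y restores the factor \<rho>(x_G) that \<open>b\<close> set
    aside.\<close>
  have E_total: "(\<integral>\<^sup>+z. ennreal (E (fst z) (snd z)) \<partial>?Q) = ennreal (family_density \<beta> I {G} / mean ^ e)"
  proof -
    have "(\<integral>\<^sup>+y. ennreal (E x y) \<partial>unit_lborel) = ennreal (downset_weight \<beta> G x / mean ^ e)" for x
    proof -
      have "(\<integral>\<^sup>+y. ennreal (E x y) \<partial>unit_lborel) = ennreal (\<integral>y. E x y \<partial>unit_lborel)"
        unfolding E_def w_def using nonneg(4)[of x]
        by (intro nn_integral_eq_integral integrable_divide integrable_mult_left prod_W_integrable)
          (auto simp: E_def w_def)
      also have "(\<integral>y. E x y \<partial>unit_lborel) = codegree G x * \<Phi> x / mean ^ e"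
        by (simp add: E_def w_def codegree_def)
      also have "codegree G x * \<Phi> x = downset_weight \<beta> G x"
      proof -
        have "downset_weight \<beta> G x = (\<Prod>F\<in>P. codegree F x ^ b F * (if F = G then codegree G x else 1))"
          unfolding downset_weight_def P_def[symmetric]
          by (intro prod.cong refl) (auto simp: b power_add)
        then show ?thesis using P by (simp add: prod.distrib \<Phi>_def)
      qed
      finally show ?thesis .
    qed
    then have "(\<integral>\<^sup>+z. ennreal (E (fst z) (snd z)) \<partial>?Q) =
        (\<integral>\<^sup>+x. ennreal (downset_weight \<beta> G x / mean ^ e) \<partial>cube I)"
      by (subst iterate(1)[OF meas(3)]) simp
    also have "\<dots> = ennreal (\<integral>x. downset_weight \<beta> G x / mean ^ e \<partial>cube I)"
      by (intro nn_integral_eq_integral integrable_divide C.integrable_bounded_borel AE_I2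
          bounded_borel_downset_weight assms(2) divide_nonneg_nonneg downset_weight_nonneg
          zero_le_power mean_nonneg)
    finally show ?thesis by (simp add: family_density_def)
  qed
  have pointwise: "real e * q x y \<le> E x y + (\<Sum>F\<in>P. b F * T F x y) + m * D x y"
    if pos: "0 < w G x y \<longrightarrow> (\<forall>F\<in>Pow G. 0 < codegree F x)" for x y
  proof (cases "w G x y = 0 \<or> marginal y = 0")
    case True
    \<comment> \<open>Both quantities stand in the numerator of q.\<close>
    then have "q x y = 0" by (auto simp: q_def)
    moreover have "0 \<le> E x y + (\<Sum>F\<in>P. b F * T F x y) + m * D x y"
      using nonneg by (intro add_nonneg_nonneg sum_nonneg mult_nonneg_nonneg) auto
    ultimately show ?thesis by simp
  next
    case False
    then have w: "w G x y > 0" and d: "marginal y > 0"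
      using w_nonneg[of G x y] marginal_nonneg[of y] by auto
    have c: "codegree F x > 0" if "F \<in> P" for F
      using pos w that by (auto simp: P_def)
    define a where "a = (\<lambda>F. codegree F x / marginal y ^ (card F - 1))"
    have q_pos: "q x y > 0" using w d p by (simp add: q_def)
    have ineq: "real e \<le> (\<Prod>F\<in>P. a F ^ b F) * marginal y ^ m / mean ^ (e - 1) +
        (\<Sum>F\<in>P. b F * (mean / a F)) + m * (mean / marginal y)"
      using weighted_AM_GM[OF P(1) _ d p, of a b m] c d by (simp add: e_eq a_def)
    \<comment> \<open>The denominators of the \<open>a F\<close> absorb all of d(y)^m except the
      power r - 1, which q compensates.\<close>
    have U: "(\<Prod>F\<in>P. a F ^ b F) * marginal y ^ m = \<Phi> x * marginal y ^ (r - 1)"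
    proof -
      have "(\<Prod>F\<in>P. a F ^ b F) * marginal y ^ (\<Sum>F\<in>P. b F * (card F - 1)) =
          (\<Prod>F\<in>P. a F ^ b F * marginal y ^ (b F * (card F - 1)))"
        by (simp add: prod.distrib power_sum)
      also have "\<dots> = \<Phi> x"
        unfolding \<Phi>_def a_def using d
        by (intro prod.cong refl) (simp add: power_divide power_mult[symmetric] mult.commute)
      finally show ?thesis by (simp add: m_def power_add)
    qed
    have dr: "marginal y ^ r = marginal y * marginal y ^ (r - 1)"
      using P_sub(3)[OF P(2)] by (simp add: r_def power_eq_if)
    have me: "mean ^ e = mean * mean ^ (e - 1)"
      by (simp add: e_eq)
    have qE: "q x y * ((\<Prod>F\<in>P. a F ^ b F) * marginal y ^ m / mean ^ (e - 1)) = E x y"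
      unfolding U q_def E_def dr me using d p by (simp add: field_simps)
    have qT: "q x y * (mean / a F) = T F x y" if "F \<in> P" for F
    proof -
      have "marginal y ^ card F = marginal y * marginal y ^ (card F - 1)"
        using P_sub(3)[OF that] by (simp add: power_eq_if)
      then show ?thesis using d p c[OF that] by (simp add: q_def T_def a_def field_simps)
    qed
    have qD: "q x y * (mean / marginal y) = D x y"
      using d p by (simp add: q_def D_def field_simps)
    have "q x y * real e \<le> q x y * ((\<Prod>F\<in>P. a F ^ b F) * marginal y ^ m / mean ^ (e - 1) +
        (\<Sum>F\<in>P. b F * (mean / a F)) + m * (mean / marginal y))"
      using ineq q_pos by (intro mult_left_mono) auto
    also have "\<dots> = E x y + (\<Sum>F\<in>P. b F * (q x y * (mean / a F))) + m * D x y"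
      by (simp only: distrib_left sum_distrib_left mult.left_commute[of "q x y"] qE qD)
    also have "\<dots> = E x y + (\<Sum>F\<in>P. b F * T F x y) + m * D x y"
      by (simp only: qT cong: sum.cong)
    finally show ?thesis by (simp only: mult.commute)
  qed
  have ennreal_rhs: "ennreal (E x y + (\<Sum>F\<in>P. b F * T F x y) + m * D x y) =
      ennreal (E x y) + (\<Sum>F\<in>P. ennreal (b F) * ennreal (T F x y)) + ennreal m * ennreal (D x y)"
    for x y
  proof -
    have pos: "0 \<le> b F * T F x y" "0 \<le> m * D x y" "0 \<le> (\<Sum>F\<in>P. b F * T F x y)" for F
      by (intro mult_nonneg_nonneg sum_nonneg nonneg of_nat_0_le_iff)+
    have "ennreal (E x y + (\<Sum>F\<in>P. b F * T F x y) + m * D x y) =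
        ennreal (E x y) + ennreal (\<Sum>F\<in>P. b F * T F x y) + ennreal (m * D x y)"
      by (simp only: ennreal_plus nonneg pos add_nonneg_nonneg)
    also have "ennreal (\<Sum>F\<in>P. b F * T F x y) = (\<Sum>F\<in>P. ennreal (b F * T F x y))"
      by (intro sum_ennreal[symmetric] pos)
    finally show ?thesis
      by (simp only: ennreal_mult nonneg of_nat_0_le_iff)
  qed
  have quot_nonneg: "0 \<le> family_density \<beta> I {G} / mean ^ e"
    by (intro divide_nonneg_nonneg family_density_nonneg zero_le_power mean_nonneg)
  \<comment> \<open>As q has total mass 1, integrating the pointwise bound gives e \<le> t({G}) /
    p^e + (e - 1).\<close>
  have "ennreal e = (\<integral>\<^sup>+z. ennreal e * ennreal (q (fst z) (snd z)) \<partial>?Q)"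
    by (subst nn_integral_cmult) (simp_all add: q_total)
  also have "\<dots> = (\<integral>\<^sup>+x. \<integral>\<^sup>+y. ennreal (e * q x y) \<partial>unit_lborel \<partial>cube I)"
    using iterate(1)[of "\<lambda>x y. e * q x y"] nonneg(1) by (simp add: ennreal_mult)
  also have "\<dots> \<le> (\<integral>\<^sup>+x. \<integral>\<^sup>+y. ennreal (E x y + (\<Sum>F\<in>P. b F * T F x y) + m * D x y)
      \<partial>unit_lborel \<partial>cube I)"
  \<comment> \<open>The bound is available for each x at almost every y, which is why the integrals
    are iterated here.\<close>
  proof (rule nn_integral_mono, rule nn_integral_mono_AE)
    fix x
    show "AE y in unit_lborel. ennreal (e * q x y) \<le>
        ennreal (E x y + (\<Sum>F\<in>P. b F * T F x y) + m * D x y)"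
      using AE_codegree_pos[OF fin, of x]
      by eventually_elim (intro ennreal_leI pointwise, simp add: w_def)
  qed
  also have "\<dots> = (\<integral>\<^sup>+z. ennreal (E (fst z) (snd z) + (\<Sum>F\<in>P. b F * T F (fst z) (snd z)) +
      m * D (fst z) (snd z)) \<partial>?Q)"
    by (intro iterate(1)[of "\<lambda>x y. E x y + (\<Sum>F\<in>P. b F * T F x y) + m * D x y",
        symmetric] borel_measurable_add borel_measurable_sum borel_measurable_times
        borel_measurable_const meas T_meas)
  also have "\<dots> = (\<integral>\<^sup>+z. ennreal (E (fst z) (snd z)) + (\<Sum>F\<in>P. ennreal (b F) * ennreal (T F (fst z) (snd z))) +
      ennreal m * ennreal (D (fst z) (snd z)) \<partial>?Q)"
    by (simp only: ennreal_rhs)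
  also have "\<dots> = (\<integral>\<^sup>+z. ennreal (E (fst z) (snd z)) \<partial>?Q) +
      (\<Sum>F\<in>P. ennreal (b F) * (\<integral>\<^sup>+z. ennreal (T F (fst z) (snd z)) \<partial>?Q)) +
      ennreal m * (\<integral>\<^sup>+z. ennreal (D (fst z) (snd z)) \<partial>?Q)"
    using T_meas by (simp add: nn_integral_add nn_integral_sum nn_integral_cmult del: sum_ennreal)
  also have "\<dots> \<le> ennreal (family_density \<beta> I {G} / mean ^ e) + (\<Sum>F\<in>P. ennreal (b F) * 1) + ennreal m * 1"
    unfolding E_total by (intro add_mono order_refl sum_mono mult_left_mono T_total D_total) auto
  also have "\<dots> = ennreal (family_density \<beta> I {G} / mean ^ e + (\<Sum>F\<in>P. b F) + m)"
    using quot_nonneg by (simp add: sum_nonneg ennreal_plus[symmetric] del: ennreal_plus)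
  finally have "real e \<le> family_density \<beta> I {G} / mean ^ e + (\<Sum>F\<in>P. b F) + m"
    by (subst (asm) ennreal_le_iff) (intro add_nonneg_nonneg quot_nonneg sum_nonneg of_nat_0_le_iff)
  then have "1 \<le> family_density \<beta> I {G} / mean ^ e" by (simp add: e_eq)
  then show ?thesis
    using p by (simp add: e_def P_def pos_le_divide_eq)
qed

end

subsection \<open>All r-sets\<close>

text \<open>Removing F is a bijection onto subsets of the complement. The count is the multiplicity
  of \<rho>(x_F) in the product over all r-sets, which is where the divisor of
  \<open>\<alpha> k\<close> comes from.\<close>

lemma card_supersets:
  assumes "finite I" "F \<subseteq> I" "card F \<le> r"
  shows "card {G. F \<subseteq> G \<and> G \<subseteq> I \<and> card G = r} = (card I - card F) choose (r - card F)"
proof -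
  have fin: "finite F" using assms(1,2) finite_subset by blast
  have "bij_betw (\<lambda>G. G - F) {G. F \<subseteq> G \<and> G \<subseteq> I \<and> card G = r}
      {H. H \<subseteq> I - F \<and> card H = r - card F}"
  proof (rule bij_betw_byWitness[where f' = "\<lambda>H. H \<union> F"])
    show "(\<lambda>G. G - F) ` {G. F \<subseteq> G \<and> G \<subseteq> I \<and> card G = r} \<subseteq> {H. H \<subseteq> I - F \<and> card H = r - card F}"
      using fin by (auto simp: card_Diff_subset)
    have "card (H \<union> F) = r" if "H \<subseteq> I - F" "card H = r - card F" for H
    proof -
      have "finite H" using that(1) assms(1) finite_subset by blast
      moreover have "H \<inter> F = {}" using that(1) by blast
      ultimately show ?thesis using that(2) fin assms(3) by (simp add: card_Un_disjoint)
    qed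
    then show "(\<lambda>H. H \<union> F) ` {H. H \<subseteq> I - F \<and> card H = r - card F} \<subseteq> {G. F \<subseteq> G \<and> G \<subseteq> I \<and> card G = r}"
      using assms(2) by auto
  qed auto
  then have "card {G. F \<subseteq> G \<and> G \<subseteq> I \<and> card G = r} = card {H. H \<subseteq> I - F \<and> card H = r - card F}"
    by (rule bij_betw_same_card)
  also have "\<dots> = card (I - F) choose (r - card F)"
    using assms(1) by (intro n_subsets) simp
  finally show ?thesis using assms(2) fin by (simp add: card_Diff_subset)
qed

lemma sum_nonempty_subsets:
  fixes h :: "nat \<Rightarrow> nat"
  assumes "finite G"
  shows "(\<Sum>F\<in>Pow G - {{}}. h (card F)) = (\<Sum>k=1..card G. (card G choose k) * h k)"
proof -
  have "(\<Sum>F\<in>Pow G - {{}}. h (card F)) =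
      (\<Sum>k=1..card G. \<Sum>F\<in>{F. F \<in> Pow G - {{}} \<and> card F = k}. h (card F))"
  proof (rule sum.group[symmetric])
    show "card ` (Pow G - {{}}) \<subseteq> {1..card G}"
    proof (rule image_subsetI)
      fix F assume "F \<in> Pow G - {{}}"
      moreover from this have "finite F" using assms finite_subset by blast
      ultimately show "card F \<in> {1..card G}"
        using card_mono[OF assms, of F] by (auto simp: Suc_le_eq card_gt_0_iff)
    qed
  qed (use assms in auto)
  also have "\<dots> = (\<Sum>k=1..card G. (card G choose k) * h k)"
  proof (intro sum.cong refl)
    fix k assume "k \<in> {1..card G}"
    then have "{F. F \<in> Pow G - {{}} \<and> card F = k} = {F. F \<subseteq> G \<and> card F = k}" by auto
    then show "(\<Sum>F\<in>{F. F \<in> Pow G - {{}} \<and> card F = k}. h (card F)) = (card G choose k) * h k"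
      using n_subsets[OF assms, of k] by simp
  qed
  finally show ?thesis .
qed

context bounded_kernel
begin

text \<open>Regroup the integrand by r-sets, pass to a single r-set with
  \<open>single_downset_density_le\<close>, and bound that one with
  \<open>single_downset_density_ge\<close>.\<close>

theorem downset_density_ge:
  fixes I :: "'i set"
  assumes "finite I" "1 \<le> r" "r \<le> card I"
    and dvd: "\<And>k. 1 \<le> k \<Longrightarrow> k \<le> r \<Longrightarrow> ((card I - k) choose (r - k)) dvd \<alpha> k"
    and "\<alpha> r > 0"
  shows "mean ^ (\<Sum>k=1..r. k * (card I choose k) * \<alpha> k) \<le>
    (\<integral>x. (\<Prod>F\<in>{F. F \<subseteq> I \<and> 1 \<le> card F \<and> card F \<le> r}. codegree F x ^ \<alpha> (card F)) \<partial>cube I)"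
proof -
  define \<beta> where "\<beta> = (\<lambda>k. \<alpha> k div ((card I - k) choose (r - k)))"
  have \<alpha>: "\<alpha> k = \<beta> k * ((card I - k) choose (r - k))" if "1 \<le> k" "k \<le> r" for k
    using dvd[OF that] by (simp add: \<beta>_def)
  define \<K> where "\<K> = {G. G \<subseteq> I \<and> card G = r}"
  define \<P> where "\<P> = {F. F \<subseteq> I \<and> 1 \<le> card F \<and> card F \<le> r}"
  have fin: "finite \<K>" "finite \<P>" using assms(1) by (simp_all add: \<K>_def \<P>_def)
  obtain G where G: "G \<subseteq> I" "card G = r"
    using obtain_subset_with_card_n[OF assms(3)] by metis
  have "G \<noteq> {}" "finite G" using G assms(1,2) finite_subset by auto
  have "(\<Prod>G\<in>\<K>. downset_weight \<beta> G x) = (\<Prod>F\<in>\<P>. codegree F x ^ \<alpha> (card F))" for x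
  proof -
    have "(\<Prod>G\<in>\<K>. downset_weight \<beta> G x) =
        (\<Prod>G\<in>\<K>. \<Prod>F\<in>{F. F \<in> \<P> \<and> F \<subseteq> G}. codegree F x ^ \<beta> (card F))"
    proof (intro prod.cong refl)
      fix H assume "H \<in> \<K>"
      then have H: "H \<subseteq> I" "card H = r" "finite H"
        using assms(1) finite_subset by (auto simp: \<K>_def)
      have "Pow H - {{}} = {F. F \<in> \<P> \<and> F \<subseteq> H}"
      proof (intro set_eqI iffI)
        fix F assume F: "F \<in> Pow H - {{}}"
        moreover have "finite F" using F H(3) finite_subset by blast
        ultimately show "F \<in> {F. F \<in> \<P> \<and> F \<subseteq> H}"
          using H card_mono[OF H(3), of F] by (auto simp: \<P>_def Suc_le_eq card_gt_0_iff)
      qed (auto simp: \<P>_def)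
      then show "downset_weight \<beta> H x = (\<Prod>F\<in>{F. F \<in> \<P> \<and> F \<subseteq> H}. codegree F x ^ \<beta> (card F))"
        by (simp add: downset_weight_def)
    qed
    \<comment> \<open>For fixed F the factor is now repeated once per r-set above F, which turns
      \<beta> into \<alpha>.\<close>
    also have "\<dots> = (\<Prod>F\<in>\<P>. \<Prod>G\<in>{G. G \<in> \<K> \<and> F \<subseteq> G}. codegree F x ^ \<beta> (card F))"
      using fin by (rule prod.swap_restrict)
    also have "\<dots> = (\<Prod>F\<in>\<P>. codegree F x ^ \<alpha> (card F))"
    proof (intro prod.cong refl)
      fix F assume "F \<in> \<P>"
      then have F: "F \<subseteq> I" "1 \<le> card F" "card F \<le> r" by (auto simp: \<P>_def)
      have "{G. G \<in> \<K> \<and> F \<subseteq> G} = {G. F \<subseteq> G \<and> G \<subseteq> I \<and> card G = r}" by (auto simp: \<K>_def)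
      then show "(\<Prod>G\<in>{G. G \<in> \<K> \<and> F \<subseteq> G}. codegree F x ^ \<beta> (card F)) = codegree F x ^ \<alpha> (card F)"
        using card_supersets[OF assms(1) F(1,3)] \<alpha>[OF F(2,3)] by (simp add: power_mult)
    qed
    finally show ?thesis .
  qed
  then have density: "(\<integral>x. (\<Prod>F\<in>\<P>. codegree F x ^ \<alpha> (card F)) \<partial>cube I) = family_density \<beta> I \<K>"
    by (simp add: family_density_def)
  have "(\<Sum>F\<in>Pow G - {{}}. card F * \<beta> (card F)) * (card I choose r) =
      (\<Sum>k=1..r. (r choose k) * (k * \<beta> k)) * (card I choose r)"
    using sum_nonempty_subsets[OF \<open>finite G\<close>, of "\<lambda>k. k * \<beta> k"] G(2) by simp
  also have "\<dots> = (\<Sum>k=1..r. k * (card I choose k) * \<alpha> k)"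
    unfolding sum_distrib_right
  proof (intro sum.cong refl)
    fix k assume k: "k \<in> {1..r}"
    have "(r choose k) * (k * \<beta> k) * (card I choose r) =
        k * \<beta> k * ((card I choose r) * (r choose k))" by simp
    \<comment> \<open>Both sides count the pairs of a k-set inside an r-set of I.\<close>
    also have "(card I choose r) * (r choose k) = (card I choose k) * ((card I - k) choose (r - k))"
      using k assms(3) by (intro choose_mult) auto
    finally show "(r choose k) * (k * \<beta> k) * (card I choose r) = k * (card I choose k) * \<alpha> k"
      using \<alpha>[of k] k by simp
  qed
  finally have exponent: "(\<Sum>F\<in>Pow G - {{}}. card F * \<beta> (card F)) * (card I choose r) =
      (\<Sum>k=1..r. k * (card I choose k) * \<alpha> k)" .
  have "\<beta> (card G) > 0" using assms(5) \<alpha>[of r] assms(2) G(2) by simp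
  then have "mean ^ (\<Sum>F\<in>Pow G - {{}}. card F * \<beta> (card F)) \<le> family_density \<beta> I {G}"
    by (rule single_downset_density_ge[OF assms(1) G(1) \<open>G \<noteq> {}\<close>])
  then have "(mean ^ (\<Sum>F\<in>Pow G - {{}}. card F * \<beta> (card F))) ^ (card I choose r) \<le>
      family_density \<beta> I {G} ^ (card I choose r)"
    using mean_nonneg by (intro power_mono) auto
  also have "\<dots> \<le> family_density \<beta> I \<K>"
    using single_downset_density_le[OF assms(1) G(1), of \<beta>] G(2) by (simp add: \<K>_def)
  finally show ?thesis
    unfolding density[unfolded \<P>_def] by (simp only: power_mult[symmetric] exponent)
qed

end

subsection \<open>From Lebesgue to Borel measurability\<close>

text \<open>On a complete measure, agreement almost everywhere with a measurable function already
  gives measurability.\<close>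

lemma integral_completion_AE_eq:
  fixes f g :: "'a \<Rightarrow> real"
  assumes g: "g \<in> borel_measurable M" and eq: "AE x in M. f x = g x"
  shows "integral\<^sup>L (completion M) f = integral\<^sup>L M g"
proof -
  have eq': "AE x in completion M. f x = g x"
    using eq by (rule AE_completion)
  have "f \<in> borel_measurable (completion M)"
  proof (rule measurableI)
    fix A :: "real set" assume A: "A \<in> sets borel"
    show "f -` A \<inter> space (completion M) \<in> sets (completion M)"
    proof (rule completion.in_sets_AE)
      show "AE x in completion M. (x \<in> g -` A \<inter> space M) = (x \<in> f -` A \<inter> space (completion M))"
        using eq' by eventually_elim simp
      show "g -` A \<inter> space M \<in> sets (completion M)"
        using measurable_sets[OF g A] by simp
    qed simp
  qed simp
  then have "integral\<^sup>L (completion M) f = integral\<^sup>L (completion M) g"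
    using eq' measurable_completion[OF g] by (intro integral_cong_AE)
  also have "\<dots> = integral\<^sup>L M g"
    using g by (rule integral_completion)
  finally show ?thesis .
qed

text \<open>Multiplying by the indicator of \<Omega> reduces this to the whole space;
  \<open>lebesgue_on\<close> is such a restriction of a completion.\<close>

lemma integral_restrict_completion_AE_eq:
  fixes f g :: "'a \<Rightarrow> real"
  assumes \<Omega>: "\<Omega> \<in> sets M" and g: "g \<in> borel_measurable M" and eq: "AE x in M. x \<in> \<Omega> \<longrightarrow> f x = g x"
  shows "integral\<^sup>L (restrict_space (completion M) \<Omega>) f = integral\<^sup>L (restrict_space M \<Omega>) g"
proof -
  have \<Omega>': "\<Omega> \<inter> space M \<in> sets M" using \<Omega> by simp
  have "integral\<^sup>L (restrict_space (completion M) \<Omega>) f = (\<integral>x. indicator \<Omega> x *\<^sub>R f x \<partial>completion M)"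
    using \<Omega>' by (intro integral_restrict_space) simp
  also have "\<dots> = (\<integral>x. indicator \<Omega> x *\<^sub>R g x \<partial>M)"
  proof (rule integral_completion_AE_eq)
    show "(\<lambda>x. indicator \<Omega> x *\<^sub>R g x) \<in> borel_measurable M" using \<Omega> g by simp
    show "AE x in M. indicator \<Omega> x *\<^sub>R f x = indicator \<Omega> x *\<^sub>R g x"
      using eq by eventually_elim (simp add: indicator_def)
  qed
  also have "\<dots> = integral\<^sup>L (restrict_space M \<Omega>) g"
    using \<Omega>' by (intro integral_restrict_space[symmetric])
  finally show ?thesis .
qed

text \<open>Extend W by 0 outside the square and take a Borel function that equals the extension
  almost everywhere.\<close>

lemma graphon_borel_representative:
  assumes "graphon W"
  obtains V where "bounded_kernel V" "AE z in lborel. z \<in> {0..1} \<times> {0..1} \<longrightarrow> case_prod W z = case_prod V z"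
proof -
  let ?S = "{0..1::real} \<times> {0..1::real}"
  have bounds: "0 \<le> W x y \<and> W x y \<le> 1" if "(x, y) \<in> ?S" for x y
    using assms that by (auto simp: graphon_def)
  have S: "?S \<in> sets lebesgue" by (simp add: borel_closed closed_Times)
  have "case_prod W \<in> borel_measurable (lebesgue_on ?S)"
    using assms by (simp add: graphon_def)
  then have "(\<lambda>z. indicator ?S z *\<^sub>R case_prod W z) \<in> borel_measurable lebesgue"
    using S by (subst (asm) borel_measurable_restrict_space_iff) simp_all
  then obtain g where g: "g \<in> borel_measurable lborel"
    "AE z in lborel. indicator ?S z *\<^sub>R case_prod W z = g z"
    using completion_ex_borel_measurable_real by blast
  \<comment> \<open>Clamping forces the bounds everywhere and changes nothing where the value
    already lies in [0,1].\<close>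
  define V where "V = (\<lambda>x y. max 0 (min 1 (g (x, y))))"
  have "bounded_kernel V"
  proof
    have [measurable]: "g \<in> borel_measurable (borel \<Otimes>\<^sub>M borel)"
      using g(1) by (simp add: borel_prod)
    show "case_prod V \<in> borel_measurable (borel \<Otimes>\<^sub>M borel)"
      unfolding V_def case_prod_beta' by measurable
  qed (auto simp: V_def)
  moreover have "AE z in lborel. z \<in> ?S \<longrightarrow> case_prod W z = case_prod V z"
    using g(2)
  proof eventually_elim
    case (elim z)
    then show ?case using bounds[of "fst z" "snd z"] by (auto simp: V_def)
  qed
  ultimately show thesis by (rule that)
qed

context bounded_kernel
begin

text \<open>Cut off to the square, the kernel is integrable over the plane, and Fubini with y
  outermost produces \<open>marginal\<close>.\<close>

lemma edge_density_eq_mean: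
  assumes eq: "AE z in lborel. z \<in> {0..1} \<times> {0..1} \<longrightarrow> case_prod W' z = case_prod W z"
  shows "edge_density W' = mean"
proof -
  let ?S = "{0..1::real} \<times> {0..1::real}"
  have S: "?S \<in> sets lborel" by (simp add: borel_closed closed_Times)
  have W: "case_prod W \<in> borel_measurable lborel"
    using W_borel by (simp add: borel_prod)
  define f where "f = (\<lambda>z. indicator ?S z *\<^sub>R case_prod W z)"
  have "emeasure lborel ?S < \<infinity>"
    using emeasure_bounded_finite[of ?S] by (simp add: bounded_Times)
  then have "integrable lborel (\<lambda>z. indicator ?S z :: real)"
    using S by simp
  then have "integrable lborel f"
    unfolding f_def by (rule Bochner_Integration.integrable_bound)
      (use S W W_nonneg W_le_one in \<open>auto simp: indicator_def\<close>)
  then have int: "integrable (lborel \<Otimes>\<^sub>M lborel) (\<lambda>(x, y). f (x, y))"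
    by (simp add: lborel_prod)
  have "edge_density W' = integral\<^sup>L (restrict_space lborel ?S) (case_prod W)"
    unfolding edge_density_def using S W eq by (rule integral_restrict_completion_AE_eq)
  also have "\<dots> = (\<integral>z. f z \<partial>lborel)"
    unfolding f_def using S by (intro integral_restrict_space) simp
  also have "\<dots> = (\<integral>(x, y). f (x, y) \<partial>(lborel \<Otimes>\<^sub>M lborel))"
    by (simp add: lborel_prod)
  also have "\<dots> = (\<integral>y. \<integral>x. f (x, y) \<partial>lborel \<partial>lborel)"
    by (rule lborel_pair.integral_snd[OF int, symmetric])
  also have "\<dots> = (\<integral>y. indicator {0..1} y *\<^sub>R (\<integral>x. indicator {0..1} x *\<^sub>R W x y \<partial>lborel) \<partial>lborel)"
    by (intro Bochner_Integration.integral_cong refl) (simp add: f_def indicator_times mult_ac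
        integral_mult_right_zero[symmetric] del: integral_mult_right_zero integral_mult_left_zero)
  also have "\<dots> = mean"
    unfolding mean_def marginal_def by (simp add: integral_restrict_space)
  finally show ?thesis .
qed

text \<open>For almost every s the sections of W' and W at s agree almost everywhere. As I is
  finite, almost every x has all its coordinates among these s.\<close>

lemma AE_rho_eq_codegree:
  fixes I :: "'i set"
  assumes eq: "AE z in lborel. z \<in> {0..1} \<times> {0..1} \<longrightarrow> case_prod W' z = case_prod W z"
    and "finite I"
  shows "AE x in cube I. \<forall>F\<subseteq>I. rho W' F x = codegree F x"
proof -
  have "AE x in lborel. AE y in lborel.
      (x, y) \<in> {0..1} \<times> {0..1} \<longrightarrow> case_prod W' (x, y) = case_prod W (x, y)"
    by (rule lborel_pair.AE_pair[OF eq[folded lborel_prod]])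
  then have "AE x in lborel. x \<in> {0..1} \<longrightarrow> (AE y in lborel. y \<in> {0..1} \<longrightarrow> W' x y = W x y)"
  proof eventually_elim
    case (elim x)
    show ?case
    proof
      assume "x \<in> {0..1}"
      from elim show "AE y in lborel. y \<in> {0..1} \<longrightarrow> W' x y = W x y"
        by eventually_elim (use \<open>x \<in> {0..1}\<close> in simp)
    qed
  qed
  then have good: "AE x in unit_lborel. AE y in lborel. y \<in> {0..1} \<longrightarrow> W' x y = W x y"
    by (subst AE_restrict_space_iff) auto
  have "AE x in cube I. \<forall>i\<in>I. AE y in lborel. y \<in> {0..1} \<longrightarrow> W' (x i) y = W (x i) y"
    using assms(2) good prob_space_unit_lborel
    by (intro AE_finite_allI AE_PiM_component[where P = "\<lambda>s. AE y in lborel. y \<in> {0..1} \<longrightarrow> W' s y = W s y"])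
  then show ?thesis
  proof eventually_elim
    case (elim x)
    show ?case
    proof (intro allI impI)
      fix F assume "F \<subseteq> I"
      then have "finite F" using assms(2) finite_subset by blast
      have "AE y in lborel. \<forall>i\<in>F. y \<in> {0..1} \<longrightarrow> W' (x i) y = W (x i) y"
        using elim \<open>F \<subseteq> I\<close> \<open>finite F\<close> by (intro AE_finite_allI) auto
      then have "AE y in lborel. y \<in> {0..1} \<longrightarrow> (\<Prod>i\<in>F. W' (x i) y) = (\<Prod>i\<in>F. W (x i) y)"
        by eventually_elim simp
      moreover have "(\<lambda>y. \<Prod>i\<in>F. W (x i) y) \<in> borel_measurable lborel"
        by (intro borel_measurable_prod W_measurable) simp_all
      ultimately show "rho W' F x = codegree F x"
        unfolding rho_def codegree_def by (intro integral_restrict_completion_AE_eq) simp_all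
    qed
  qed
qed

end

theorem theorem3p1:
  fixes m r :: nat
    and \<alpha> :: "nat \<Rightarrow> nat"
    and W :: "real \<Rightarrow> real \<Rightarrow> real"
  assumes "1 \<le> r" and "r \<le> m"
    and "\<And>k. 1 \<le> k \<Longrightarrow> k \<le> r \<Longrightarrow> ((m - k) choose (r - k)) dvd \<alpha> k"
    and "\<alpha> r > 0"
    and "graphon W"
  shows "weighted_hom_density (downset_graph m r) (\<lambda>F. \<alpha> (card F)) W
           \<ge> edge_density W ^ (\<Sum>k = 1..r. k * (m choose k) * \<alpha> k)"
proof -
  \<comment> \<open>Passing to a Borel version V changes neither of the two densities.\<close>
  obtain V where V: "bounded_kernel V"
    "AE z in lborel. z \<in> {0..1} \<times> {0..1} \<longrightarrow> case_prod W z = case_prod V z"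
    using graphon_borel_representative[OF assms(5)] .
  interpret bounded_kernel V by (rule V(1))
  define \<P> where "\<P> = {F. F \<subseteq> {1..m} \<and> 1 \<le> card F \<and> card F \<le> r}"
  have "weighted_hom_density (downset_graph m r) (\<lambda>F. \<alpha> (card F)) W =
      (\<integral>x. (\<Prod>F\<in>\<P>. rho W F x ^ \<alpha> (card F)) \<partial>completion (cube {1..m}))"
    by (simp only: weighted_hom_density_downset_graph unit_cube_def \<P>_def)
  also have "\<dots> = (\<integral>x. (\<Prod>F\<in>\<P>. codegree F x ^ \<alpha> (card F)) \<partial>cube {1..m})"
  proof (rule integral_completion_AE_eq)
    show "(\<lambda>x. \<Prod>F\<in>\<P>. codegree F x ^ \<alpha> (card F)) \<in> borel_measurable (cube {1..m})"
      by (intro borel_measurable_prod borel_measurable_power codegree_measurable) (simp add: \<P>_def)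
    show "AE x in cube {1..m}. (\<Prod>F\<in>\<P>. rho W F x ^ \<alpha> (card F)) = (\<Prod>F\<in>\<P>. codegree F x ^ \<alpha> (card F))"
      using AE_rho_eq_codegree[OF V(2) finite_atLeastAtMost]
      by eventually_elim (simp add: \<P>_def)
  qed
  finally show ?thesis
    using downset_density_ge[of "{1..m}" r \<alpha>] assms(1-4)
    unfolding edge_density_eq_mean[OF V(2)] \<P>_def by simp
qed

end
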